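(* Let $\mu$ be a sign partition of a positive integer $n$. Then $\mu$ has no repeated parts, except that the part $1$ may be repeated once; that is, every integer $a\ge 2$ occurs at most once as a part of $\mu$, and $1$ occurs at most twice as a part of $\mu$.
   Context: For partitions $\lambda,\mu$ of $n$, $[\lambda](\mu)$ denotes the value of the irreducible complex character $[\lambda]$ of the symmetric group $S_n$ labelled by $\lambda$ on the conjugacy class of elements of cycle type $\mu$. A partition $\mu$ of $n$ is a sign partition if $[\lambda](\mu)\in\{0,1,-1\}$ for all partitions $\lambda$ of $n$. *)

theory Defs
  imports Complex_Main "HOL-Library.Function_Algebras" "HOL-Library.Multiset"
    "HOL-Combinatorics.Combinatorics"
begin

text \<open>Partitions are weakly decreasing lists of positive parts; \<open>S\<^sub>n\<close> is the group of
  permutations of \<open>{..<n}\<close>.\<close>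

definition is_partition :: "nat list \<Rightarrow> nat \<Rightarrow> bool" where
  "is_partition \<alpha> n \<longleftrightarrow> sorted_wrt (\<ge>) \<alpha> \<and> 0 \<notin> set \<alpha> \<and> sum_list \<alpha> = n"

definition perms :: "nat \<Rightarrow> (nat \<Rightarrow> nat) set" where
  "perms n = {\<sigma>. \<sigma> permutes {..<n}}"

text \<open>The image below is a set of orbits, so every cycle (fixed points included) contributes
  its length exactly once.\<close>

definition cycle_type :: "nat \<Rightarrow> (nat \<Rightarrow> nat) \<Rightarrow> nat multiset" where
  "cycle_type n \<sigma> = image_mset card (mset_set (orbit \<sigma> ` {..<n}))"

text \<open>An element \<open>\<Sum>\<^sub>\<sigma> f(\<sigma>) \<sigma>\<close> of the complex group algebra of \<open>S\<^sub>n\<close> is represented by its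
  coefficient function \<open>f\<close>.\<close>

definition group_algebra :: "nat \<Rightarrow> ((nat \<Rightarrow> nat) \<Rightarrow> complex) set" where
  "group_algebra n = {f. \<forall>\<sigma>. \<sigma> \<notin> perms n \<longrightarrow> f \<sigma> = 0}"

definition ga_mult ::
  "nat \<Rightarrow> ((nat \<Rightarrow> nat) \<Rightarrow> complex) \<Rightarrow> ((nat \<Rightarrow> nat) \<Rightarrow> complex) \<Rightarrow> (nat \<Rightarrow> nat) \<Rightarrow> complex" where
  "ga_mult n f g =
     (\<lambda>\<sigma>. if \<sigma> \<in> perms n then (\<Sum>\<tau>\<in>perms n. f \<tau> * g (inv \<tau> \<circ> \<sigma>)) else 0)"

definition left_translate ::
  "(nat \<Rightarrow> nat) \<Rightarrow> ((nat \<Rightarrow> nat) \<Rightarrow> complex) \<Rightarrow> (nat \<Rightarrow> nat) \<Rightarrow> complex" where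
  "left_translate \<sigma> f = (\<lambda>\<tau>. f (inv \<sigma> \<circ> \<tau>))"

text \<open>The boxes (row, column) of the Young diagram of \<open>\<alpha>\<close>, read row by row. This is also a
  tableau: box number \<open>x\<close> of the list contains the entry \<open>x\<close>.\<close>

definition boxes :: "nat list \<Rightarrow> (nat \<times> nat) list" where
  "boxes \<alpha> = concat (map (\<lambda>i. map (\<lambda>j. (i, j)) [0..<\<alpha> ! i]) [0..<length \<alpha>])"

definition row_group :: "nat list \<Rightarrow> (nat \<Rightarrow> nat) set" where
  "row_group \<alpha> = {\<sigma> \<in> perms (sum_list \<alpha>).
     \<forall>x<sum_list \<alpha>. fst (boxes \<alpha> ! \<sigma> x) = fst (boxes \<alpha> ! x)}"

definition column_group :: "nat list \<Rightarrow> (nat \<Rightarrow> nat) set" where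
  "column_group \<alpha> = {\<sigma> \<in> perms (sum_list \<alpha>).
     \<forall>x<sum_list \<alpha>. snd (boxes \<alpha> ! \<sigma> x) = snd (boxes \<alpha> ! x)}"

definition row_symmetrizer :: "nat list \<Rightarrow> (nat \<Rightarrow> nat) \<Rightarrow> complex" where
  "row_symmetrizer \<alpha> = (\<lambda>\<sigma>. if \<sigma> \<in> row_group \<alpha> then 1 else 0)"

definition column_antisymmetrizer :: "nat list \<Rightarrow> (nat \<Rightarrow> nat) \<Rightarrow> complex" where
  "column_antisymmetrizer \<alpha> = (\<lambda>\<sigma>. if \<sigma> \<in> column_group \<alpha> then of_int (sign \<sigma>) else 0)"

definition young_symmetrizer :: "nat list \<Rightarrow> (nat \<Rightarrow> nat) \<Rightarrow> complex" where
  "young_symmetrizer \<alpha> =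
     ga_mult (sum_list \<alpha>) (row_symmetrizer \<alpha>) (column_antisymmetrizer \<alpha>)"

text \<open>The left ideal \<open>\<complex>[S\<^sub>n] c\<^sub>\<alpha>\<close> generated by the Young symmetrizer: the Specht module, i.e. the
  irreducible representation of \<open>S\<^sub>n\<close> labelled by \<open>\<alpha>\<close> in the usual convention, where \<open>(n)\<close> labels the
  trivial and \<open>(1\<^sup>n)\<close> the sign representation.\<close>

definition specht_module :: "nat list \<Rightarrow> ((nat \<Rightarrow> nat) \<Rightarrow> complex) set" where
  "specht_module \<alpha> =
     (\<lambda>f. ga_mult (sum_list \<alpha>) f (young_symmetrizer \<alpha>)) ` group_algebra (sum_list \<alpha>)"

definition fun_scale :: "complex \<Rightarrow> ('a \<Rightarrow> complex) \<Rightarrow> 'a \<Rightarrow> complex" where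
  "fun_scale c f = (\<lambda>x. c * f x)"

global_interpretation fun_space: vector_space fun_scale
  by unfold_locales (auto simp: fun_scale_def fun_eq_iff algebra_simps)

text \<open>The trace of an endomorphism \<open>T\<close> of a finite-dimensional subspace \<open>V\<close>; it does not depend
  on the chosen basis.\<close>

definition trace_on ::
  "('a \<Rightarrow> complex) set \<Rightarrow> (('a \<Rightarrow> complex) \<Rightarrow> ('a \<Rightarrow> complex)) \<Rightarrow> complex" where
  "trace_on V T =
     (let B = (SOME B. fun_space.independent B \<and> fun_space.span B = V)
      in \<Sum>b\<in>B. fun_space.representation B (T b) b)"

definition irr_char :: "nat list \<Rightarrow> (nat \<Rightarrow> nat) \<Rightarrow> complex" where
  "irr_char \<alpha> \<sigma> = trace_on (specht_module \<alpha>) (left_translate \<sigma>)"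

text \<open>The value \<open>[\<alpha>](\<mu>)\<close> on the class of cycle type \<open>\<mu>\<close>, for partitions \<open>\<alpha>\<close> and \<open>\<mu>\<close> of the same
  number. Characters are class functions, so the chosen class representative is immaterial.\<close>

definition char_value :: "nat list \<Rightarrow> nat list \<Rightarrow> complex" where
  "char_value \<alpha> \<mu> =
     irr_char \<alpha> (SOME \<sigma>. \<sigma> \<in> perms (sum_list \<mu>) \<and> cycle_type (sum_list \<mu>) \<sigma> = mset \<mu>)"

definition sign_partition :: "nat list \<Rightarrow> nat \<Rightarrow> bool" where
  "sign_partition \<mu> n \<longleftrightarrow>
     is_partition \<mu> n \<and> (\<forall>\<alpha>. is_partition \<alpha> n \<longrightarrow> char_value \<alpha> \<mu> \<in> {0, 1, -1})"

end

theory Submission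
  imports Defs
begin

text \<open>
Write \<open>\<chi>(g)\<close> for the value of an irreducible character at a permutation \<open>g\<close>, and let \<open>K(g)\<close> be the
conjugacy class of \<open>g\<close>. Three facts carry the proof.

  \<^item> Column orthogonality: \<open>\<Sum>\<^sub>\<chi> \<chi>(g)\<^sup>2 = n! / |K(g)|\<close> (\<open>column_orthogonality\<close>).
  \<^item> Parity: the values \<open>\<chi>(g)\<close> are integers. If \<open>h\<close> arises from \<open>g\<close> by replacing two cycles of
    length \<open>a\<close> by one cycle of length \<open>2a\<close>, then \<open>\<chi>(g)\<close> and \<open>\<chi>(h)\<close> have the same parity
    (\<open>char_int_local_square\<close>). In terms of symmetric functions this is \<open>p\<^sub>a\<^sup>2 \<equiv> p\<^sub>2\<^sub>a\<close> modulo \<open>2\<close>.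
  \<^item> Double counting: if \<open>g\<close> has \<open>m\<close> cycles of length \<open>a\<close> and \<open>k\<close> of length \<open>2a\<close>, then
    \<open>|K(g)| a m (m - 1) \<le> 2 (k + 1) |K(h)|\<close> (\<open>merge_count\<close>).

Suppose that all values at \<open>g\<close> are \<open>0\<close>, \<open>1\<close> or \<open>-1\<close>. By parity \<open>\<chi>(g)\<^sup>2 \<le> \<chi>(h)\<^sup>2\<close> for every
\<open>\<chi>\<close>, hence \<open>|K(h)| \<le> |K(g)|\<close> by orthogonality, and therefore \<open>a m (m - 1) \<le> 2 (k + 1)\<close>; in the
case of equality all values at \<open>h\<close> are \<open>0\<close>, \<open>1\<close> or \<open>-1\<close> as well (\<open>merge_sign_element\<close>). Let \<open>a\<close>
be the largest repeated part. Then \<open>k \<le> 1\<close>, so \<open>a m (m - 1) \<le> 4\<close>. This leaves \<open>a = 1\<close>, \<open>m = 2\<close>,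
which is the permitted repetition, and \<open>a = m = 2\<close>, \<open>k = 1\<close> with equality. In the latter case
\<open>h\<close> has two cycles of length \<open>4\<close> and at most one of length \<open>8\<close>, and the same bound for \<open>h\<close> and
\<open>a = 4\<close> reads \<open>8 \<le> 4\<close>, a contradiction (\<open>sign_element_multiplicity\<close>).

The character theory comes from the Young symmetrizers \<open>c\<^sub>\<alpha>\<close>. A counting argument on Young
diagrams shows \<open>c\<^sub>\<alpha> f c\<^sub>\<beta> = 0\<close> for \<open>\<alpha> \<noteq> \<beta>\<close> and that \<open>c\<^sub>\<alpha> f c\<^sub>\<alpha>\<close> is a multiple of \<open>c\<^sub>\<alpha>\<close>
(\<open>young_orthogonal\<close>, \<open>young_sandwich_scalar\<close>), while positivity shows that \<open>c\<^sub>\<alpha>\<close> is a nonzero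
multiple of an idempotent (\<open>young_square\<close>). The trace on the Specht module becomes a sum over
\<open>S\<^sub>n\<close> of coefficients of this idempotent, from which row orthogonality follows by reindexing
(\<open>irr_char_orthogonal\<close>). As permutations of the same cycle type are conjugate, there are no more
classes than partitions, so the characters form a basis of the class functions and the columns of
the character table are orthogonal, too.

For parity, \<open>\<int>[S\<^sub>n] c\<^sub>\<alpha>\<close> is a lattice in the Specht module on which the group acts by integer
matrices, and \<open>tr (M\<^sup>2) \<equiv> tr M\<close> modulo \<open>2\<close> for such a matrix; hence \<open>\<chi>(\<sigma>\<^sup>2) \<equiv> \<chi>(\<sigma>)\<close>
(\<open>irr_char_integral_square\<close>). After replacing \<open>h\<close> by a suitable conjugate, \<open>g\<close> and
\<open>h\<close> have a common power whose exponent is a power of two.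
\<close>

section \<open>Permutations and the group algebra\<close>

lemma finite_perms [simp, intro]: "finite (perms n)"
  by (simp add: perms_def finite_permutations)

lemma card_perms: "card (perms n) = fact n"
  unfolding perms_def using card_permutations[of "{..<n}" n] by simp

lemma perms_closed [simp, intro]:
  "id \<in> perms n"
  "\<sigma> \<in> perms n \<Longrightarrow> inv \<sigma> \<in> perms n"
  "\<sigma> \<in> perms n \<Longrightarrow> \<tau> \<in> perms n \<Longrightarrow> \<sigma> \<circ> \<tau> \<in> perms n"
  by (auto simp: perms_def permutes_inv permutes_compose permutes_id)

lemma perms_bij: "\<sigma> \<in> perms n \<Longrightarrow> bij \<sigma>"
  by (auto simp: perms_def permutes_bij)

lemma perms_group:
  assumes "\<sigma> \<in> perms n"
  shows "inv (inv \<sigma>) = \<sigma>" "\<sigma> \<circ> inv \<sigma> = id" "inv \<sigma> \<circ> \<sigma> = id"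
    "inv \<sigma> \<circ> (\<sigma> \<circ> \<rho>) = \<rho>" "\<sigma> \<circ> (inv \<sigma> \<circ> \<rho>) = \<rho>" "\<rho> \<circ> \<sigma> \<circ> inv \<sigma> = \<rho>" "\<rho> \<circ> inv \<sigma> \<circ> \<sigma> = \<rho>"
    "inv \<sigma> (\<sigma> x) = x" "\<sigma> (inv \<sigma> x) = x"
proof -
  have b: "bij \<sigma>" by (rule perms_bij[OF assms])
  then show "inv (inv \<sigma>) = \<sigma>" by (rule inv_inv_eq)
  have 1: "\<sigma> (inv \<sigma> x) = x" "inv \<sigma> (\<sigma> x) = x" for x
    using b by (simp_all add: bij_is_surj surj_f_inv_f bij_is_inj inv_f_f)
  show "\<sigma> \<circ> inv \<sigma> = id" "inv \<sigma> \<circ> \<sigma> = id"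
    "inv \<sigma> \<circ> (\<sigma> \<circ> \<rho>) = \<rho>" "\<sigma> \<circ> (inv \<sigma> \<circ> \<rho>) = \<rho>" "\<rho> \<circ> \<sigma> \<circ> inv \<sigma> = \<rho>" "\<rho> \<circ> inv \<sigma> \<circ> \<sigma> = \<rho>"
    "inv \<sigma> (\<sigma> x) = x" "\<sigma> (inv \<sigma> x) = x"
    by (simp_all add: fun_eq_iff 1)
qed

lemma perms_inv_comp:
  "\<sigma> \<in> perms n \<Longrightarrow> \<tau> \<in> perms n \<Longrightarrow> inv (\<sigma> \<circ> \<tau>) = inv \<tau> \<circ> inv \<sigma>"
  by (simp add: o_inv_distrib perms_bij)

lemma perms_comp_iff [simp]:
  assumes "\<sigma> \<in> perms n"
  shows "\<sigma> \<circ> \<tau> \<in> perms n \<longleftrightarrow> \<tau> \<in> perms n" "\<tau> \<circ> \<sigma> \<in> perms n \<longleftrightarrow> \<tau> \<in> perms n"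
  using perms_closed(3)[OF perms_closed(2)[OF assms], of "\<sigma> \<circ> \<tau>"]
    perms_closed(3)[OF _ perms_closed(2)[OF assms], of "\<tau> \<circ> \<sigma>"]
    perms_closed(3)[OF assms, of \<tau>] perms_closed(3)[OF _ assms, of \<tau>]
  unfolding perms_group(4,6)[OF assms] by metis+

lemma perms_less: "\<sigma> \<in> perms n \<Longrightarrow> \<sigma> x < n \<longleftrightarrow> x < n"
  using permutes_in_image[of \<sigma> "{..<n}" x] by (simp add: perms_def)

lemma perms_inj: "\<sigma> \<in> perms n \<Longrightarrow> \<sigma> x = \<sigma> y \<longleftrightarrow> x = y"
  using perms_bij[of \<sigma> n] by (auto simp: bij_def inj_def)

lemma sum_perms_inv: "(\<Sum>\<sigma>\<in>perms n. f (inv \<sigma>)) = (\<Sum>\<sigma>\<in>perms n. f \<sigma>)"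
  by (rule sum.reindex_bij_witness[of _ inv inv]) (auto simp: perms_group)

lemma sum_perms_left:
  "\<tau> \<in> perms n \<Longrightarrow> (\<Sum>\<sigma>\<in>perms n. f (\<tau> \<circ> \<sigma>)) = (\<Sum>\<sigma>\<in>perms n. f \<sigma>)"
  by (rule sum.reindex_bij_witness[of _ "\<lambda>\<sigma>. inv \<tau> \<circ> \<sigma>" "\<lambda>\<sigma>. \<tau> \<circ> \<sigma>"]) (auto simp: perms_group)

text \<open>The locale only fixes \<open>n\<close>, so that the product of the group algebra can be written as an infix
operator and the group laws of \<open>perms n\<close> can be simplification rules.\<close>

locale sym_algebra =
  fixes n :: nat
begin

lemmas inv_comp = perms_inv_comp[where n = n]

declare perms_group[where n = n, simp] perms_less[where n = n, simp]

abbreviation mult :: "((nat \<Rightarrow> nat) \<Rightarrow> complex) \<Rightarrow> ((nat \<Rightarrow> nat) \<Rightarrow> complex) \<Rightarrow> (nat \<Rightarrow> nat) \<Rightarrow> complex"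
    (infixl "\<star>" 70) where
  "f \<star> g \<equiv> ga_mult n f g"

definition delta :: "(nat \<Rightarrow> nat) \<Rightarrow> (nat \<Rightarrow> nat) \<Rightarrow> complex" where
  "delta \<sigma> = (\<lambda>\<tau>. if \<tau> = \<sigma> then 1 else 0)"

text \<open>The linear extension of \<open>\<sigma> \<mapsto> \<sigma>\<^sup>-\<^sup>1\<close>. The case distinction is needed because \<open>inv \<sigma>\<close> is an
arbitrary function when \<open>\<sigma>\<close> is not a bijection, and might then lie in \<open>perms n\<close>.\<close>

definition flip :: "((nat \<Rightarrow> nat) \<Rightarrow> complex) \<Rightarrow> (nat \<Rightarrow> nat) \<Rightarrow> complex" where
  "flip f = (\<lambda>\<sigma>. if \<sigma> \<in> perms n then f (inv \<sigma>) else 0)"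

lemma mult_eq: "\<sigma> \<in> perms n \<Longrightarrow> (f \<star> g) \<sigma> = (\<Sum>\<tau>\<in>perms n. f \<tau> * g (inv \<tau> \<circ> \<sigma>))"
  by (simp add: ga_mult_def)

lemma mult_outside: "\<sigma> \<notin> perms n \<Longrightarrow> (f \<star> g) \<sigma> = 0"
  by (simp add: ga_mult_def)

lemma mult_in [simp, intro]: "f \<star> g \<in> group_algebra n"
  by (simp add: group_algebra_def mult_outside)

lemma delta_in [simp, intro]: "\<sigma> \<in> perms n \<Longrightarrow> delta \<sigma> \<in> group_algebra n"
  by (auto simp: group_algebra_def delta_def)

lemma ga_eqI:
  assumes "f \<in> group_algebra n" "g \<in> group_algebra n" "\<And>\<sigma>. \<sigma> \<in> perms n \<Longrightarrow> f \<sigma> = g \<sigma>"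
  shows "f = g"
proof
  fix \<sigma> show "f \<sigma> = g \<sigma>"
    using assms by (cases "\<sigma> \<in> perms n") (auto simp: group_algebra_def)
qed

lemma mult_assoc: "f \<star> g \<star> h = f \<star> (g \<star> h)"
proof (rule ga_eqI; simp?)
  fix \<sigma> assume s: "\<sigma> \<in> perms n"
  have "(f \<star> g \<star> h) \<sigma> = (\<Sum>\<tau>\<in>perms n. \<Sum>\<rho>\<in>perms n. f \<rho> * g (inv \<rho> \<circ> \<tau>) * h (inv \<tau> \<circ> \<sigma>))"
    using s by (simp add: mult_eq sum_distrib_right)
  also have "\<dots> = (\<Sum>\<rho>\<in>perms n. \<Sum>\<tau>\<in>perms n. f \<rho> * g (inv \<rho> \<circ> \<tau>) * h (inv \<tau> \<circ> \<sigma>))"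
    by (rule sum.swap)
  also have "\<dots> = (\<Sum>\<rho>\<in>perms n. \<Sum>\<tau>\<in>perms n. f \<rho> * (g \<tau> * h (inv \<tau> \<circ> (inv \<rho> \<circ> \<sigma>))))"
  proof (rule sum.cong[OF refl])
    fix \<rho> assume r: "\<rho> \<in> perms n"
    have "(\<Sum>\<tau>\<in>perms n. f \<rho> * g (inv \<rho> \<circ> \<tau>) * h (inv \<tau> \<circ> \<sigma>)) =
      (\<Sum>\<tau>\<in>perms n. f \<rho> * g (inv \<rho> \<circ> (\<rho> \<circ> \<tau>)) * h (inv (\<rho> \<circ> \<tau>) \<circ> \<sigma>))"
      by (rule sum_perms_left[OF r, symmetric])
    also have "\<dots> = (\<Sum>\<tau>\<in>perms n. f \<rho> * (g \<tau> * h (inv \<tau> \<circ> (inv \<rho> \<circ> \<sigma>))))"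
      by (rule sum.cong) (use r in \<open>simp_all add: inv_comp comp_assoc mult.assoc\<close>)
    finally show "(\<Sum>\<tau>\<in>perms n. f \<rho> * g (inv \<rho> \<circ> \<tau>) * h (inv \<tau> \<circ> \<sigma>)) = \<dots>" .
  qed
  also have "\<dots> = (f \<star> (g \<star> h)) \<sigma>"
    using s by (simp add: mult_eq sum_distrib_left)
  finally show "(f \<star> g \<star> h) \<sigma> = (f \<star> (g \<star> h)) \<sigma>" .
qed

lemma scale_in [simp, intro]: "f \<in> group_algebra n \<Longrightarrow> fun_scale k f \<in> group_algebra n"
  by (simp add: group_algebra_def fun_scale_def)

lemma mult_scale [simp]:
  "fun_scale k f \<star> g = fun_scale k (f \<star> g)" "f \<star> fun_scale k g = fun_scale k (f \<star> g)"
  by (simp_all add: fun_eq_iff ga_mult_def fun_scale_def sum_distrib_left mult_ac)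

lemma mult_zero [simp]: "0 \<star> g = 0" "f \<star> 0 = 0"
  by (simp_all add: fun_eq_iff ga_mult_def)

lemma mult_add: "(f + g) \<star> h = f \<star> h + g \<star> h"
  by (simp add: fun_eq_iff ga_mult_def sum.distrib algebra_simps)

lemma delta_mult:
  assumes "\<sigma> \<in> perms n" "\<tau> \<in> perms n"
  shows "(delta \<sigma> \<star> f) \<tau> = f (inv \<sigma> \<circ> \<tau>)"
  using assms by (simp add: mult_eq delta_def if_distrib[of "\<lambda>x. x * _"] sum.delta cong: if_cong)

lemma mult_delta:
  assumes "\<sigma> \<in> perms n" "\<tau> \<in> perms n"
  shows "(f \<star> delta \<sigma>) \<tau> = f (\<tau> \<circ> inv \<sigma>)"
proof -
  have move: "inv \<rho> \<circ> \<tau> = \<sigma> \<longleftrightarrow> \<rho> = \<tau> \<circ> inv \<sigma>" if "\<rho> \<in> perms n" for \<rho>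
  proof
    assume "inv \<rho> \<circ> \<tau> = \<sigma>"
    then have "\<rho> \<circ> (inv \<rho> \<circ> \<tau>) \<circ> inv \<sigma> = \<rho> \<circ> \<sigma> \<circ> inv \<sigma>" by simp
    then show "\<rho> = \<tau> \<circ> inv \<sigma>" using that assms by simp
  qed (use assms in \<open>simp add: inv_comp comp_assoc\<close>)
  then have "f \<rho> * delta \<sigma> (inv \<rho> \<circ> \<tau>) = (if \<rho> = \<tau> \<circ> inv \<sigma> then f \<rho> else 0)"
    if "\<rho> \<in> perms n" for \<rho>
    unfolding delta_def move[OF that] by simp
  then have "(f \<star> delta \<sigma>) \<tau> = (\<Sum>\<rho>\<in>perms n. if \<rho> = \<tau> \<circ> inv \<sigma> then f \<rho> else 0)"
    unfolding mult_eq[OF assms(2)] by (rule sum.cong[OF refl])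
  then show ?thesis using assms by simp
qed

lemma delta_delta: "\<sigma> \<in> perms n \<Longrightarrow> \<tau> \<in> perms n \<Longrightarrow> delta \<sigma> \<star> delta \<tau> = delta (\<sigma> \<circ> \<tau>)"
proof (rule ga_eqI; simp?)
  fix \<rho> assume a: "\<sigma> \<in> perms n" "\<tau> \<in> perms n" "\<rho> \<in> perms n"
  have "inv \<sigma> \<circ> \<rho> = \<tau> \<longleftrightarrow> \<rho> = \<sigma> \<circ> \<tau>"
    using a by (metis perms_group(4,5))
  then show "(delta \<sigma> \<star> delta \<tau>) \<rho> = delta (\<sigma> \<circ> \<tau>) \<rho>"
    using a by (simp add: delta_mult) (simp add: delta_def)
qed

text \<open>Bilinearity in the form in which it is used below: what is known about \<open>f \<sigma> h\<close> for all group
elements \<open>\<sigma>\<close> carries over to \<open>f g h\<close> for every \<open>g\<close>.\<close>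

lemma mult_expand:
  assumes "\<tau> \<in> perms n"
  shows "(f \<star> g \<star> h) \<tau> = (\<Sum>\<sigma>\<in>perms n. g \<sigma> * (f \<star> delta \<sigma> \<star> h) \<tau>)"
proof -
  have "(\<Sum>\<sigma>\<in>perms n. g \<sigma> * (f \<star> delta \<sigma> \<star> h) \<tau>) =
    (\<Sum>\<sigma>\<in>perms n. \<Sum>\<rho>\<in>perms n. f \<rho> * (g \<sigma> * h (inv \<sigma> \<circ> (inv \<rho> \<circ> \<tau>))))"
    using assms by (simp add: mult_assoc mult_eq[of \<tau>] delta_mult sum_distrib_left mult_ac)
  also have "\<dots> = (\<Sum>\<rho>\<in>perms n. \<Sum>\<sigma>\<in>perms n. f \<rho> * (g \<sigma> * h (inv \<sigma> \<circ> (inv \<rho> \<circ> \<tau>))))"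
    by (rule sum.swap)
  also have "\<dots> = (f \<star> g \<star> h) \<tau>"
    using assms by (simp add: mult_assoc mult_eq sum_distrib_left)
  finally show ?thesis by simp
qed

lemma flip_in [simp, intro]: "flip f \<in> group_algebra n"
  by (simp add: flip_def group_algebra_def)

lemma flip_mult: "flip (f \<star> g) = flip g \<star> flip f"
proof (rule ga_eqI; simp?)
  fix \<sigma> assume s: "\<sigma> \<in> perms n"
  have "(flip g \<star> flip f) \<sigma> = (\<Sum>\<rho>\<in>perms n. g (inv \<rho>) * f (inv \<sigma> \<circ> \<rho>))"
    using s by (simp add: mult_eq flip_def inv_comp)
  also have "\<dots> = (\<Sum>\<rho>\<in>perms n. g (inv (\<sigma> \<circ> \<rho>)) * f (inv \<sigma> \<circ> (\<sigma> \<circ> \<rho>)))"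
    by (rule sum_perms_left[OF s, symmetric])
  also have "\<dots> = flip (f \<star> g) \<sigma>"
    using s by (simp add: mult_eq flip_def inv_comp mult_ac)
  finally show "flip (f \<star> g) \<sigma> = (flip g \<star> flip f) \<sigma>" by simp
qed

lemma integral_mult: "(\<And>\<sigma>. f \<sigma> \<in> \<int>) \<Longrightarrow> (\<And>\<sigma>. g \<sigma> \<in> \<int>) \<Longrightarrow> (f \<star> g) \<sigma> \<in> \<int>"
  by (auto simp: ga_mult_def intro!: Ints_sum Ints_mult)

text \<open>The coefficient of the identity in \<open>f f\<^sup>*\<close> is the sum of the squares of the coefficients of \<open>f\<close>.
This positivity replaces the usual trace argument in the proof that Young symmetrizers are not
nilpotent.\<close>

lemma mult_flip_eq_0:
  assumes f: "f \<in> group_algebra n" "\<And>\<sigma>. f \<sigma> \<in> \<int>" and 0: "f \<star> flip f = 0"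
  shows "f = 0"
proof (rule ga_eqI)
  show "f \<in> group_algebra n" by fact
  show "0 \<in> group_algebra n" by (simp add: group_algebra_def)
  have re: "f \<sigma> = of_real (Re (f \<sigma>))" for \<sigma>
    using f(2)[of \<sigma>] by (auto elim!: Ints_cases)
  have "(f \<star> flip f) id = (\<Sum>\<tau>\<in>perms n. f \<tau> * f \<tau>)"
    by (simp add: mult_eq flip_def)
  also have "\<dots> = (\<Sum>\<tau>\<in>perms n. of_real ((Re (f \<tau>))\<^sup>2))"
    by (rule sum.cong) (simp, metis re of_real_mult power2_eq_square)
  finally have "(\<Sum>\<tau>\<in>perms n. of_real ((Re (f \<tau>))\<^sup>2)) = (0::complex)" using 0 by simp
  then have "(\<Sum>\<tau>\<in>perms n. (Re (f \<tau>))\<^sup>2) = 0"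
    by (metis of_real_eq_0_iff of_real_sum)
  then have "\<forall>\<tau>\<in>perms n. Re (f \<tau>) = 0"
    by (subst (asm) sum_nonneg_eq_0_iff) auto
  then show "f \<sigma> = 0 \<sigma>" if "\<sigma> \<in> perms n" for \<sigma>
    using re[of \<sigma>] that by simp
qed

end

section \<open>Young diagrams and dominance\<close>

text \<open>Padding with zeros makes partial sums of partitions of different lengths comparable.\<close>

definition part :: "nat list \<Rightarrow> nat \<Rightarrow> nat" where
  "part \<alpha> k = (if k < length \<alpha> then \<alpha> ! k else 0)"

definition row_of :: "nat list \<Rightarrow> nat \<Rightarrow> nat" where
  "row_of \<alpha> x = fst (boxes \<alpha> ! x)"

definition col_of :: "nat list \<Rightarrow> nat \<Rightarrow> nat" where
  "col_of \<alpha> x = snd (boxes \<alpha> ! x)"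

definition dominated :: "nat list \<Rightarrow> nat list \<Rightarrow> bool" where
  "dominated \<alpha> \<beta> \<longleftrightarrow> (\<forall>i. (\<Sum>k<i. part \<alpha> k) \<le> (\<Sum>k<i. part \<beta> k))"

lemma part_antimono:
  assumes "is_partition \<alpha> n" "i \<le> j"
  shows "part \<alpha> j \<le> part \<alpha> i"
  using assms sorted_wrt_nth_less[of "(\<ge>)" \<alpha> i j]
  by (cases "i = j") (auto simp: part_def is_partition_def)

lemma finite_part: "finite {k. j < part \<alpha> k}"
  by (rule finite_subset[of _ "{..<length \<alpha>}"]) (auto simp: part_def split: if_splits)

lemma sum_part: "sum_list \<alpha> = (\<Sum>k<length \<alpha>. part \<alpha> k)"
  by (simp add: sum_list_sum_nth part_def atLeast0LessThan)

lemma part_le: "is_partition \<alpha> n \<Longrightarrow> part \<alpha> k \<le> n"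
  by (auto simp: part_def is_partition_def member_le_sum_list)

lemma set_boxes: "set (boxes \<alpha>) = {(i, j). j < part \<alpha> i}"
  by (auto simp: boxes_def part_def split: if_splits)

lemma length_boxes: "length (boxes \<alpha>) = sum_list \<alpha>"
proof -
  have "length (boxes \<alpha>) = sum_list (map (\<lambda>i. \<alpha> ! i) [0..<length \<alpha>])"
    by (simp add: boxes_def length_concat comp_def)
  then show ?thesis by (simp add: map_nth)
qed

lemma distinct_boxes: "distinct (boxes \<alpha>)"
proof (rule card_distinct)
  have "{(i, j). j < part \<alpha> i} = (SIGMA i:{..<length \<alpha>}. {..<part \<alpha> i})"
    by (auto simp: part_def split: if_splits)
  then show "card (set (boxes \<alpha>)) = length (boxes \<alpha>)"
    by (simp add: set_boxes length_boxes sum_part)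
qed

lemma bij_boxes:
  assumes "is_partition \<alpha> n"
  shows "bij_betw (\<lambda>x. (row_of \<alpha> x, col_of \<alpha> x)) {..<n} {(i, j). j < part \<alpha> i}"
  using bij_betw_nth[OF distinct_boxes, of "{..<n}" \<alpha> "{(i, j). j < part \<alpha> i}"] assms
  by (simp add: set_boxes length_boxes is_partition_def row_of_def col_of_def)

lemma box_inj:
  assumes "is_partition \<alpha> n" "x < n" "y < n" "row_of \<alpha> x = row_of \<alpha> y" "col_of \<alpha> x = col_of \<alpha> y"
  shows "x = y"
  using bij_betw_imp_inj_on[OF bij_boxes[OF assms(1)]] assms(2-) by (auto simp: inj_on_def)

lemma col_less: "is_partition \<alpha> n \<Longrightarrow> x < n \<Longrightarrow> col_of \<alpha> x < part \<alpha> (row_of \<alpha> x)"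
  using bij_betwE[OF bij_boxes[of \<alpha> n]] by auto

lemma box_ex:
  assumes "is_partition \<alpha> n" "j < part \<alpha> i"
  obtains x where "x < n" "row_of \<alpha> x = i" "col_of \<alpha> x = j"
proof -
  have "(i, j) \<in> (\<lambda>x. (row_of \<alpha> x, col_of \<alpha> x)) ` {..<n}"
    using bij_betw_imp_surj_on[OF bij_boxes[OF assms(1)]] assms(2) by simp
  then show ?thesis using that by auto
qed

lemma card_column:
  assumes "is_partition \<alpha> n"
  shows "card {x. x < n \<and> col_of \<alpha> x = j} = card {k. j < part \<alpha> k}"
proof (rule bij_betw_same_card[of "row_of \<alpha>"])
  show "bij_betw (row_of \<alpha>) {x. x < n \<and> col_of \<alpha> x = j} {k. j < part \<alpha> k}"
    unfolding bij_betw_def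
  proof
    show "inj_on (row_of \<alpha>) {x. x < n \<and> col_of \<alpha> x = j}"
      using box_inj[OF assms] by (auto simp: inj_on_def)
    show "row_of \<alpha> ` {x. x < n \<and> col_of \<alpha> x = j} = {k. j < part \<alpha> k}"
      using col_less[OF assms] by (auto elim!: box_ex[OF assms])
  qed
qed

lemma card_rows:
  assumes "is_partition \<alpha> n"
  shows "card {x. x < n \<and> row_of \<alpha> x < i} = (\<Sum>k<i. part \<alpha> k)"
proof -
  have "bij_betw (\<lambda>x. (row_of \<alpha> x, col_of \<alpha> x)) {x. x < n \<and> row_of \<alpha> x < i}
      (SIGMA k:{..<i}. {..<part \<alpha> k})"
    unfolding bij_betw_def
  proof
    show "inj_on (\<lambda>x. (row_of \<alpha> x, col_of \<alpha> x)) {x. x < n \<and> row_of \<alpha> x < i}"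
      using box_inj[OF assms] by (auto simp: inj_on_def)
    show "(\<lambda>x. (row_of \<alpha> x, col_of \<alpha> x)) ` {x. x < n \<and> row_of \<alpha> x < i} =
      (SIGMA k:{..<i}. {..<part \<alpha> k})"
      using col_less[OF assms] by (force elim!: box_ex[OF assms])
  qed
  then show ?thesis by (simp add: bij_betw_same_card)
qed

text \<open>Consider cells \<open>(r x, c x)\<close> that form a 0/1 matrix with the column sums of the diagram with rows
\<open>p\<close>. In that diagram every column is pushed to the top, so it meets the first \<open>i\<close> rows in as many
cells as is possible at all: either in all \<open>i\<close> of them, or with its full length.\<close>

lemma column_count_le:
  fixes r c p :: "nat \<Rightarrow> nat"
  assumes inj: "inj_on (\<lambda>x. (r x, c x)) {..<n}"
    and col: "card {x. x < n \<and> c x = j} = card {k. j < p k}"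
    and fin: "finite {k. j < p k}" and anti: "antimono p"
  shows "card {x. x < n \<and> r x < i \<and> c x = j} \<le> card {k. k < i \<and> j < p k}"
proof (cases "\<forall>k<i. j < p k")
  case True
  have "card {x. x < n \<and> r x < i \<and> c x = j} \<le> card {..<i}"
    by (rule card_inj_on_le[of r]) (use inj in \<open>auto simp: inj_on_def\<close>)
  moreover have "{k. k < i \<and> j < p k} = {..<i}" using True by auto
  ultimately show ?thesis by simp
next
  case False
  then obtain k0 where "k0 < i" "p k0 \<le> j" by auto
  then have "p k \<le> j" if "i \<le> k" for k
    using antimonoD[OF anti, of k0 k] that by linarith
  then have "{k. k < i \<and> j < p k} = {k. j < p k}"
    using not_less by blast
  moreover have "card {x. x < n \<and> r x < i \<and> c x = j} \<le> card {x. x < n \<and> c x = j}"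
    by (rule card_mono) auto
  ultimately show ?thesis using col by simp
qed

lemma sum_column_counts:
  fixes r c :: "nat \<Rightarrow> nat"
  assumes "\<And>x. x < n \<Longrightarrow> c x < N"
  shows "(\<Sum>j<N. card {x. x < n \<and> r x < i \<and> c x = j}) = card {x. x < n \<and> r x < i}"
proof -
  have "(\<Sum>j<N. card {x. x < n \<and> r x < i \<and> c x = j}) =
    (\<Sum>j<N. \<Sum>x\<in>{x\<in>{x. x < n \<and> r x < i}. c x = j}. 1)"
    by (simp add: conj_assoc)
  also have "\<dots> = (\<Sum>x\<in>{x. x < n \<and> r x < i}. 1)"
    by (rule sum.group) (use assms in auto)
  finally show ?thesis by simp
qed

lemma sum_conjugate_counts:
  fixes p :: "nat \<Rightarrow> nat"
  assumes "\<And>k. p k \<le> N"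
  shows "(\<Sum>j<N. card {k. k < i \<and> j < p k}) = (\<Sum>k<i. p k)"
proof -
  have "(\<Sum>j<N. card {k. k < i \<and> j < p k}) = (\<Sum>j<N. \<Sum>k<i. if j < p k then 1 else 0)"
    by (rule sum.cong) (simp_all add: sum.If_cases Int_def)
  also have "\<dots> = (\<Sum>k<i. \<Sum>j<N. if j < p k then 1 else 0)"
    by (rule sum.swap)
  also have "\<dots> = (\<Sum>k<i. p k)"
  proof (rule sum.cong[OF refl])
    fix k
    have "{..<N} \<inter> {j. j < p k} = {..<p k}" using assms[of k] by auto
    then show "(\<Sum>j<N. if j < p k then 1 else 0) = p k" by (simp add: sum.If_cases)
  qed
  finally show ?thesis .
qed

context sym_algebra begin

lemma card_column_perm:
  assumes "is_partition \<beta> n" "\<sigma> \<in> perms n"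
  shows "card {x. x < n \<and> col_of \<beta> (inv \<sigma> x) = j} = card {k. j < part \<beta> k}"
proof -
  have "{x. x < n \<and> col_of \<beta> (inv \<sigma> x) = j} = \<sigma> ` {x. x < n \<and> col_of \<beta> x = j}" (is "?L = ?R")
  proof (intro equalityI subsetI)
    fix x assume "x \<in> ?L"
    then show "x \<in> ?R" using assms(2)
      by (intro image_eqI[of _ _ "inv \<sigma> x"]) (auto simp: perms_less[OF perms_closed(2)])
  next
    fix x assume "x \<in> ?R"
    then show "x \<in> ?L" using assms(2) by auto
  qed
  then show ?thesis
    using card_column[OF assms(1)] perms_inj[OF assms(2)]
    by (simp add: card_image inj_on_def)
qed

text \<open>The cell of \<open>x\<close> is given by its row in the tableau of shape \<open>\<alpha>\<close> and its column in the tableau of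
shape \<open>\<beta>\<close> permuted by \<open>\<sigma>\<close>. Both the dominance of \<open>\<beta>\<close> over \<open>\<alpha>\<close> and, for \<open>\<alpha> = \<beta>\<close>, the
uniqueness of the cell pattern are read off from these three counts.\<close>

lemma rows_columns_count:
  assumes \<alpha>: "is_partition \<alpha> n" and \<beta>: "is_partition \<beta> n" and \<sigma>: "\<sigma> \<in> perms n"
    and inj: "inj_on (\<lambda>x. (row_of \<alpha> x, col_of \<beta> (inv \<sigma> x))) {..<n}"
  shows "card {x. x < n \<and> row_of \<alpha> x < i \<and> col_of \<beta> (inv \<sigma> x) = j}
      \<le> card {k. k < i \<and> j < part \<beta> k}"
    and "(\<Sum>j<n. card {x. x < n \<and> row_of \<alpha> x < i \<and> col_of \<beta> (inv \<sigma> x) = j}) = (\<Sum>k<i. part \<alpha> k)"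
    and "(\<Sum>j<n. card {k. k < i \<and> j < part \<beta> k}) = (\<Sum>k<i. part \<beta> k)"
proof -
  have "antimono (part \<beta>)" using part_antimono[OF \<beta>] by (auto simp: antimono_def)
  then show "card {x. x < n \<and> row_of \<alpha> x < i \<and> col_of \<beta> (inv \<sigma> x) = j}
      \<le> card {k. k < i \<and> j < part \<beta> k}"
    by (rule column_count_le[OF inj card_column_perm[OF \<beta> \<sigma>] finite_part])
  have "col_of \<beta> (inv \<sigma> x) < n" if "x < n" for x
    using col_less[OF \<beta>, of "inv \<sigma> x"] part_le[OF \<beta>] that \<sigma> perms_less[OF perms_closed(2)[OF \<sigma>]]
    by (meson order.strict_trans2)
  then show "(\<Sum>j<n. card {x. x < n \<and> row_of \<alpha> x < i \<and> col_of \<beta> (inv \<sigma> x) = j}) = (\<Sum>k<i. part \<alpha> k)"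
    using sum_column_counts[of n "\<lambda>x. col_of \<beta> (inv \<sigma> x)" n "row_of \<alpha>" i] card_rows[OF \<alpha>, of i]
    by simp
  show "(\<Sum>j<n. card {k. k < i \<and> j < part \<beta> k}) = (\<Sum>k<i. part \<beta> k)"
    by (rule sum_conjugate_counts) (rule part_le[OF \<beta>])
qed

text \<open>Contrapositively: if \<open>\<beta>\<close> does not dominate \<open>\<alpha>\<close>, then two entries share a row of the first tableau
and a column of the second one, and their transposition lies in both stabilizers.\<close>

lemma dominated_if_transversal:
  assumes "is_partition \<alpha> n" "is_partition \<beta> n" "\<sigma> \<in> perms n"
    and "inj_on (\<lambda>x. (row_of \<alpha> x, col_of \<beta> (inv \<sigma> x))) {..<n}"
  shows "dominated \<alpha> \<beta>"
  unfolding dominated_def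
proof
  fix i
  show "(\<Sum>k<i. part \<alpha> k) \<le> (\<Sum>k<i. part \<beta> k)"
    unfolding rows_columns_count(2,3)[OF assms, of i, symmetric]
    by (rule sum_mono) (rule rows_columns_count(1)[OF assms])
qed

lemma dominated_antisym:
  assumes "is_partition \<alpha> n" "is_partition \<beta> n" "dominated \<alpha> \<beta>" "dominated \<beta> \<alpha>"
  shows "\<alpha> = \<beta>"
proof -
  have s: "(\<Sum>k<i. part \<alpha> k) = (\<Sum>k<i. part \<beta> k)" for i
    using assms(3,4) by (simp add: dominated_def order_antisym)
  have p: "part \<alpha> k = part \<beta> k" for k
    using s[of "Suc k"] s[of k] by simp
  have pos: "part \<gamma> k \<noteq> 0 \<longleftrightarrow> k < length \<gamma>" if "is_partition \<gamma> n" for \<gamma> k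
  proof (cases "k < length \<gamma>")
    case True
    then have "\<gamma> ! k \<in> set \<gamma>" by simp
    then have "\<gamma> ! k \<noteq> 0" using that unfolding is_partition_def by metis
    then show ?thesis using True by (simp add: part_def)
  qed (simp add: part_def)
  have lt: "k < length \<alpha> \<longleftrightarrow> k < length \<beta>" for k
    unfolding pos[OF assms(1), symmetric] pos[OF assms(2), symmetric] p ..
  have "{..<length \<alpha>} = {..<length \<beta>}" unfolding lessThan_def lt ..
  then have len: "length \<alpha> = length \<beta>" by simp
  then have "\<alpha> ! k = \<beta> ! k" if "k < length \<alpha>" for k
    using p[of k] that by (simp add: part_def)
  then show ?thesis using len by (intro nth_equalityI) auto
qed

text \<open>For \<open>\<alpha> = \<beta>\<close> the upper bounds on the column counts have the same total as the counts
themselves, so they are all attained. Comparing \<open>i\<close> and \<open>i + 1\<close> rows shows that the cells are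
exactly those of the Young diagram.\<close>

lemma transversal_meets_boxes:
  assumes \<alpha>: "is_partition \<alpha> n" and \<sigma>: "\<sigma> \<in> perms n"
    and inj: "inj_on (\<lambda>x. (row_of \<alpha> x, col_of \<alpha> (inv \<sigma> x))) {..<n}"
    and x: "x < n"
  obtains y where "y < n" "row_of \<alpha> y = row_of \<alpha> x" "col_of \<alpha> (inv \<sigma> y) = col_of \<alpha> x"
proof -
  note cnt = rows_columns_count[OF \<alpha> \<alpha> \<sigma> inj]
  define A where "A i j = {y. y < n \<and> row_of \<alpha> y < i \<and> col_of \<alpha> (inv \<sigma> y) = j}" for i j
  define B where "B i j = {k. k < i \<and> j < part \<alpha> k}" for i j
  let ?i = "row_of \<alpha> x" and ?j = "col_of \<alpha> x"
  have xj: "?j < part \<alpha> ?i" by (rule col_less[OF \<alpha> x])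
  have jn: "?j < n" using xj part_le[OF \<alpha>] by (meson order.strict_trans2)
  have "card (A i j) = card (B i j)" if "j < n" for i j
  proof (rule ccontr)
    assume "card (A i j) \<noteq> card (B i j)"
    then have "(\<Sum>j<n. card (A i j)) < (\<Sum>j<n. card (B i j))"
      using cnt(1)[of i] that unfolding A_def B_def
      by (intro sum_strict_mono_ex1) (auto intro!: bexI[of _ j] simp: order.strict_iff_order)
    then show False using cnt(2,3)[of i] by (simp add: A_def B_def)
  qed
  then have eq: "card (A i ?j) = card (B i ?j)" for i using jn by simp
  have "B (Suc ?i) ?j = insert ?i (B ?i ?j)" using xj by (auto simp: B_def)
  then have "card (B (Suc ?i) ?j) = Suc (card (B ?i ?j))" by (simp add: B_def)
  \<comment> \<open>column ?j gains an entry when row ?i is added, as it does in the diagram\<close>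
  then have "A (Suc ?i) ?j \<noteq> A ?i ?j" using eq[of "Suc ?i"] eq[of ?i] by auto
  then obtain y where "y \<in> A (Suc ?i) ?j" "y \<notin> A ?i ?j" by (auto simp: A_def)
  then show ?thesis using that[of y] by (auto simp: A_def)
qed

lemma is_partition_sum: "is_partition \<alpha> n \<Longrightarrow> sum_list \<alpha> = n"
  by (simp add: is_partition_def)

lemma row_group_iff:
  "is_partition \<alpha> n \<Longrightarrow> \<sigma> \<in> row_group \<alpha> \<longleftrightarrow> \<sigma> \<in> perms n \<and> (\<forall>x<n. row_of \<alpha> (\<sigma> x) = row_of \<alpha> x)"
  by (simp add: row_group_def is_partition_sum row_of_def)

lemma column_group_iff:
  "is_partition \<alpha> n \<Longrightarrow> \<sigma> \<in> column_group \<alpha> \<longleftrightarrow> \<sigma> \<in> perms n \<and> (\<forall>x<n. col_of \<alpha> (\<sigma> x) = col_of \<alpha> x)"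
  by (simp add: column_group_def is_partition_sum col_of_def)

text \<open>Since the cell pattern is the diagram itself, every entry can be moved inside its row to the
place that \<open>\<sigma>\<close> prescribes for its column; what remains of \<open>\<sigma>\<close> then preserves columns.\<close>

lemma transversal_factor:
  assumes \<alpha>: "is_partition \<alpha> n" and \<sigma>: "\<sigma> \<in> perms n"
    and inj: "inj_on (\<lambda>x. (row_of \<alpha> x, col_of \<alpha> (inv \<sigma> x))) {..<n}"
  obtains \<pi> \<kappa> where "\<pi> \<in> row_group \<alpha>" "\<kappa> \<in> column_group \<alpha>" "\<sigma> = \<pi> \<circ> \<kappa>"
proof -
  have "\<exists>y. y < n \<and> row_of \<alpha> y = row_of \<alpha> x \<and> col_of \<alpha> (inv \<sigma> y) = col_of \<alpha> x" if "x < n" for x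
    using transversal_meets_boxes[OF assms that] by metis
  then obtain f where f: "\<And>x. x < n \<Longrightarrow> f x < n \<and> row_of \<alpha> (f x) = row_of \<alpha> x \<and>
      col_of \<alpha> (inv \<sigma> (f x)) = col_of \<alpha> x"
    by metis
  define \<pi> where "\<pi> x = (if x < n then f x else x)" for x
  have "inj_on f {..<n}"
    using f box_inj[OF \<alpha>] by (intro inj_onI) (metis lessThan_iff)
  moreover from this have "f ` {..<n} = {..<n}"
    by (intro endo_inj_surj) (use f in auto)
  ultimately have "bij_betw f {..<n} {..<n}"
    by (simp add: bij_betw_def)
  then have "bij_betw \<pi> {..<n} {..<n}"
    by (subst bij_betw_cong[of _ _ f]) (simp_all add: \<pi>_def)
  then have "\<pi> permutes {..<n}"
    by (rule bij_imp_permutes) (simp add: \<pi>_def)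
  then have \<pi>: "\<pi> \<in> perms n" by (simp add: perms_def)
  have row: "\<pi> \<in> row_group \<alpha>"
    using f \<pi> by (simp add: row_group_iff[OF \<alpha>] \<pi>_def)
  have "col_of \<alpha> ((inv \<pi> \<circ> \<sigma>) x) = col_of \<alpha> x" if x: "x < n" for x
  proof -
    define y where "y = inv \<pi> (\<sigma> x)"
    have y: "y < n" "\<pi> y = \<sigma> x" using x \<pi> \<sigma> by (simp_all add: y_def perms_less[OF perms_closed(2)])
    then have "col_of \<alpha> (inv \<sigma> (\<pi> y)) = col_of \<alpha> y"
      using f[of y] unfolding \<pi>_def by simp
    then show ?thesis using y \<sigma> by (simp add: y_def)
  qed
  then have "inv \<pi> \<circ> \<sigma> \<in> column_group \<alpha>"
    using \<pi> \<sigma> by (simp add: column_group_iff[OF \<alpha>] perms_closed)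
  then show ?thesis using that[OF row, of "inv \<pi> \<circ> \<sigma>"] \<pi> by simp
qed

end

section \<open>Young symmetrizers\<close>

context sym_algebra begin

abbreviation rs where "rs \<equiv> row_symmetrizer"
abbreviation cs where "cs \<equiv> column_antisymmetrizer"

lemma sign_comp_perms:
  "\<sigma> \<in> perms n \<Longrightarrow> \<tau> \<in> perms n \<Longrightarrow> sign (\<sigma> \<circ> \<tau>) = sign \<sigma> * sign \<tau>"
  by (intro sign_compose) (auto simp: perms_def permutation_permutes)

lemma sign_inv_perms: "\<sigma> \<in> perms n \<Longrightarrow> sign (inv \<sigma>) = sign \<sigma>"
  by (intro sign_inverse) (auto simp: perms_def permutation_permutes)

lemma row_group_closed:
  assumes \<alpha>: "is_partition \<alpha> n"
  shows "id \<in> row_group \<alpha>"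
    "\<pi> \<in> row_group \<alpha> \<Longrightarrow> \<pi> \<in> perms n"
    "\<pi> \<in> row_group \<alpha> \<Longrightarrow> inv \<pi> \<in> row_group \<alpha>"
    "\<pi> \<in> row_group \<alpha> \<Longrightarrow> \<rho> \<in> row_group \<alpha> \<Longrightarrow> \<pi> \<circ> \<rho> \<in> row_group \<alpha>"
proof -
  show "id \<in> row_group \<alpha>" "\<pi> \<in> row_group \<alpha> \<Longrightarrow> \<pi> \<in> perms n"
    "\<pi> \<in> row_group \<alpha> \<Longrightarrow> \<rho> \<in> row_group \<alpha> \<Longrightarrow> \<pi> \<circ> \<rho> \<in> row_group \<alpha>"
    by (auto simp: row_group_iff[OF \<alpha>])
  assume p: "\<pi> \<in> row_group \<alpha>"
  then have "row_of \<alpha> (inv \<pi> x) = row_of \<alpha> x" if "x < n" for x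
    using that spec[of "\<lambda>x. x < n \<longrightarrow> row_of \<alpha> (\<pi> x) = row_of \<alpha> x" "inv \<pi> x"]
    by (simp add: row_group_iff[OF \<alpha>])
  then show "inv \<pi> \<in> row_group \<alpha>" using p by (simp add: row_group_iff[OF \<alpha>])
qed

lemma column_group_closed:
  assumes \<alpha>: "is_partition \<alpha> n"
  shows "id \<in> column_group \<alpha>"
    "\<pi> \<in> column_group \<alpha> \<Longrightarrow> \<pi> \<in> perms n"
    "\<pi> \<in> column_group \<alpha> \<Longrightarrow> inv \<pi> \<in> column_group \<alpha>"
    "\<pi> \<in> column_group \<alpha> \<Longrightarrow> \<rho> \<in> column_group \<alpha> \<Longrightarrow> \<pi> \<circ> \<rho> \<in> column_group \<alpha>"
proof -
  show "id \<in> column_group \<alpha>" "\<pi> \<in> column_group \<alpha> \<Longrightarrow> \<pi> \<in> perms n"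
    "\<pi> \<in> column_group \<alpha> \<Longrightarrow> \<rho> \<in> column_group \<alpha> \<Longrightarrow> \<pi> \<circ> \<rho> \<in> column_group \<alpha>"
    by (auto simp: column_group_iff[OF \<alpha>])
  assume p: "\<pi> \<in> column_group \<alpha>"
  then have "col_of \<alpha> (inv \<pi> x) = col_of \<alpha> x" if "x < n" for x
    using that spec[of "\<lambda>x. x < n \<longrightarrow> col_of \<alpha> (\<pi> x) = col_of \<alpha> x" "inv \<pi> x"]
    by (simp add: column_group_iff[OF \<alpha>])
  then show "inv \<pi> \<in> column_group \<alpha>" using p by (simp add: column_group_iff[OF \<alpha>])
qed

lemma row_group_comp_iff:
  assumes \<alpha>: "is_partition \<alpha> n" and p: "\<pi> \<in> row_group \<alpha>"
  shows "\<pi> \<circ> \<sigma> \<in> row_group \<alpha> \<longleftrightarrow> \<sigma> \<in> row_group \<alpha>" "\<sigma> \<circ> \<pi> \<in> row_group \<alpha> \<longleftrightarrow> \<sigma> \<in> row_group \<alpha>"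
  using row_group_closed[OF \<alpha>] p perms_group(4,6)[of \<pi> n] by metis+

lemma column_group_comp_iff:
  assumes \<alpha>: "is_partition \<alpha> n" and p: "\<pi> \<in> column_group \<alpha>"
  shows "\<pi> \<circ> \<sigma> \<in> column_group \<alpha> \<longleftrightarrow> \<sigma> \<in> column_group \<alpha>"
  using column_group_closed[OF \<alpha>] p perms_group(4,6)[of \<pi> n] by metis

lemma row_column_trivial:
  assumes \<alpha>: "is_partition \<alpha> n" and "\<sigma> \<in> row_group \<alpha>" "\<sigma> \<in> column_group \<alpha>"
  shows "\<sigma> = id"
proof
  fix x
  have s: "\<sigma> permutes {..<n}" "\<sigma> \<in> perms n"
    using row_group_closed(2)[OF \<alpha> assms(2)] by (auto simp: perms_def)
  show "\<sigma> x = id x"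
  proof (cases "x < n")
    case True
    then have "row_of \<alpha> (\<sigma> x) = row_of \<alpha> x" "col_of \<alpha> (\<sigma> x) = col_of \<alpha> x" "\<sigma> x < n"
      using assms(2,3) s(2) unfolding row_group_iff[OF \<alpha>] column_group_iff[OF \<alpha>] by simp_all
    then show ?thesis using box_inj[OF \<alpha> _ True] by simp
  qed (simp add: permutes_not_in[OF s(1)])
qed

lemma rs_in: "is_partition \<alpha> n \<Longrightarrow> rs \<alpha> \<in> group_algebra n"
  and cs_in: "is_partition \<alpha> n \<Longrightarrow> cs \<alpha> \<in> group_algebra n"
  using row_group_closed(2) column_group_closed(2)
  by (auto simp: group_algebra_def row_symmetrizer_def column_antisymmetrizer_def)

lemma rs_integral: "rs \<alpha> \<sigma> \<in> \<int>" and cs_integral: "cs \<alpha> \<sigma> \<in> \<int>"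
  by (auto simp: row_symmetrizer_def column_antisymmetrizer_def)

lemma flip_rs: "is_partition \<alpha> n \<Longrightarrow> flip (rs \<alpha>) = rs \<alpha>"
proof (rule ga_eqI; (simp add: rs_in)?)
  fix \<sigma> assume a: "is_partition \<alpha> n" "\<sigma> \<in> perms n"
  have "inv \<sigma> \<in> row_group \<alpha> \<longleftrightarrow> \<sigma> \<in> row_group \<alpha>"
    using row_group_closed(3)[OF a(1)] a(2) by (metis perms_group(1))
  then show "flip (rs \<alpha>) \<sigma> = rs \<alpha> \<sigma>" using a by (simp add: flip_def row_symmetrizer_def)
qed

lemma flip_cs: "is_partition \<alpha> n \<Longrightarrow> flip (cs \<alpha>) = cs \<alpha>"
proof (rule ga_eqI; (simp add: cs_in)?)
  fix \<sigma> assume a: "is_partition \<alpha> n" "\<sigma> \<in> perms n"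
  have "inv \<sigma> \<in> column_group \<alpha> \<longleftrightarrow> \<sigma> \<in> column_group \<alpha>"
    using column_group_closed(3)[OF a(1)] a(2) by (metis perms_group(1))
  then show "flip (cs \<alpha>) \<sigma> = cs \<alpha> \<sigma>"
    using a by (simp add: flip_def column_antisymmetrizer_def sign_inv_perms)
qed

lemma rs_delta:
  assumes \<alpha>: "is_partition \<alpha> n" and p: "\<pi> \<in> row_group \<alpha>"
  shows "rs \<alpha> \<star> delta \<pi> = rs \<alpha>"
proof (rule ga_eqI; (simp add: rs_in \<alpha>)?)
  fix \<sigma> assume "\<sigma> \<in> perms n"
  then show "(rs \<alpha> \<star> delta \<pi>) \<sigma> = rs \<alpha> \<sigma>"
    using row_group_closed[OF \<alpha>] p
    by (simp add: mult_delta row_symmetrizer_def row_group_comp_iff[OF \<alpha>])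
qed

lemma delta_cs:
  assumes \<alpha>: "is_partition \<alpha> n" and p: "\<kappa> \<in> column_group \<alpha>"
  shows "delta \<kappa> \<star> cs \<alpha> = fun_scale (of_int (sign \<kappa>)) (cs \<alpha>)"
proof (rule ga_eqI; (simp add: cs_in \<alpha>)?)
  fix \<sigma> assume s: "\<sigma> \<in> perms n"
  have k: "\<kappa> \<in> perms n" "inv \<kappa> \<in> column_group \<alpha>" using column_group_closed[OF \<alpha>] p by auto
  then show "(delta \<kappa> \<star> cs \<alpha>) \<sigma> = fun_scale (of_int (sign \<kappa>)) (cs \<alpha>) \<sigma>"
    using s by (simp add: delta_mult fun_scale_def column_antisymmetrizer_def
        column_group_comp_iff[OF \<alpha>] sign_comp_perms sign_inv_perms)
qed

lemma rs_rs:
  assumes \<alpha>: "is_partition \<alpha> n"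
  shows "rs \<alpha> \<star> rs \<alpha> = fun_scale (of_nat (card (row_group \<alpha>))) (rs \<alpha>)"
proof (rule ga_eqI; (simp add: rs_in \<alpha>)?)
  fix \<sigma> assume s: "\<sigma> \<in> perms n"
  have sub: "perms n \<inter> row_group \<alpha> = row_group \<alpha>" using row_group_closed(2)[OF \<alpha>] by auto
  have "(rs \<alpha> \<star> rs \<alpha>) \<sigma> = (\<Sum>\<tau>\<in>perms n. if \<tau> \<in> row_group \<alpha> then rs \<alpha> \<sigma> else 0)"
    unfolding mult_eq[OF s]
    by (rule sum.cong)
      (auto simp: row_symmetrizer_def row_group_comp_iff[OF \<alpha>] row_group_closed[OF \<alpha>])
  then show "(rs \<alpha> \<star> rs \<alpha>) \<sigma> = fun_scale (of_nat (card (row_group \<alpha>))) (rs \<alpha>) \<sigma>"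
    by (simp add: sum.If_cases fun_scale_def sub)
qed

lemma cs_cs:
  assumes \<alpha>: "is_partition \<alpha> n"
  shows "cs \<alpha> \<star> cs \<alpha> = fun_scale (of_nat (card (column_group \<alpha>))) (cs \<alpha>)"
proof (rule ga_eqI; (simp add: cs_in \<alpha>)?)
  fix \<sigma> assume s: "\<sigma> \<in> perms n"
  have sub: "perms n \<inter> column_group \<alpha> = column_group \<alpha>" using column_group_closed(2)[OF \<alpha>] by auto
  have "cs \<alpha> \<tau> * cs \<alpha> (inv \<tau> \<circ> \<sigma>) = (if \<tau> \<in> column_group \<alpha> then cs \<alpha> \<sigma> else 0)" for \<tau>
  proof (cases "\<tau> \<in> column_group \<alpha>")
    case True
    then have t: "\<tau> \<in> perms n" "inv \<tau> \<in> column_group \<alpha>"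
      using column_group_closed[OF \<alpha>] by auto
    have "of_int (sign \<tau>) * of_int (sign \<tau>) = (1 :: complex)"
      by (metis of_int_1 of_int_mult sign_idempotent)
    then show ?thesis using True t s
      by (simp add: column_antisymmetrizer_def column_group_comp_iff[OF \<alpha>] sign_comp_perms
          sign_inv_perms mult.assoc[symmetric])
  qed (simp add: column_antisymmetrizer_def)
  then show "(cs \<alpha> \<star> cs \<alpha>) \<sigma> = fun_scale (of_nat (card (column_group \<alpha>))) (cs \<alpha>) \<sigma>"
    using s by (simp add: mult_eq sum.If_cases fun_scale_def sub)
qed

text \<open>Two entries \<open>x\<close>, \<open>y\<close> in a common row and a common (permuted) column give a transposition that the
row symmetrizer absorbs with sign \<open>1\<close> and the column antisymmetrizer with sign \<open>-1\<close>.\<close>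

lemma sandwich_vanishes:
  assumes \<alpha>: "is_partition \<alpha> n" and \<beta>: "is_partition \<beta> n" and \<sigma>: "\<sigma> \<in> perms n"
    and ninj: "\<not> inj_on (\<lambda>x. (row_of \<alpha> x, col_of \<beta> (inv \<sigma> x))) {..<n}"
  shows "rs \<alpha> \<star> delta \<sigma> \<star> cs \<beta> = 0"
proof -
  obtain x y where xy: "x < n" "y < n" "x \<noteq> y" "row_of \<alpha> x = row_of \<alpha> y"
      "col_of \<beta> (inv \<sigma> x) = col_of \<beta> (inv \<sigma> y)"
    using ninj by (auto simp: inj_on_def)
  define t where "t = transpose x y"
  define u where "u = transpose (inv \<sigma> x) (inv \<sigma> y)"
  have ixy: "inv \<sigma> x < n" "inv \<sigma> y < n" "inv \<sigma> x \<noteq> inv \<sigma> y"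
    using xy \<sigma> perms_inj[of "inv \<sigma>" n x y] by simp_all
  have tp: "t \<in> perms n" "u \<in> perms n"
    using xy ixy by (auto simp: t_def u_def perms_def intro!: permutes_swap_id)
  have tR: "t \<in> row_group \<alpha>"
    using xy tp by (auto simp: row_group_iff[OF \<alpha>] t_def transpose_def)
  have uC: "u \<in> column_group \<beta>"
    using xy tp by (auto simp: column_group_iff[OF \<beta>] u_def transpose_def)
  have "sign u = -1" using ixy by (simp add: u_def sign_swap_id)
  \<comment> \<open>u is the conjugate of t by the inverse of the permutation\<close>
  have tu: "t \<circ> \<sigma> = \<sigma> \<circ> u"
  proof
    fix z
    have "z = inv \<sigma> w \<longleftrightarrow> \<sigma> z = w" for w using \<sigma> by auto
    then show "(t \<circ> \<sigma>) z = (\<sigma> \<circ> u) z" using \<sigma> by (auto simp: t_def u_def transpose_def)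
  qed
  have "rs \<alpha> \<star> delta \<sigma> \<star> cs \<beta> = rs \<alpha> \<star> delta t \<star> delta \<sigma> \<star> cs \<beta>"
    by (simp add: rs_delta[OF \<alpha> tR])
  also have "\<dots> = rs \<alpha> \<star> delta \<sigma> \<star> (delta u \<star> cs \<beta>)"
  proof -
    have "delta t \<star> delta \<sigma> = delta \<sigma> \<star> delta u"
      using tp \<sigma> by (simp add: delta_delta tu)
    then show ?thesis by (metis mult_assoc)
  qed
  also have "\<dots> = fun_scale (-1) (rs \<alpha> \<star> delta \<sigma> \<star> cs \<beta>)"
    by (simp only: delta_cs[OF \<beta> uC] \<open>sign u = -1\<close> mult_scale of_int_minus of_int_1)
  finally show ?thesis by (simp add: fun_eq_iff fun_scale_def)
qed

lemma rs_mult_cs_eq_0: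
  assumes \<alpha>: "is_partition \<alpha> n" and \<beta>: "is_partition \<beta> n" and "\<not> dominated \<alpha> \<beta>"
  shows "rs \<alpha> \<star> f \<star> cs \<beta> = 0"
proof (rule ga_eqI)
  show "0 \<in> group_algebra n" by (simp add: group_algebra_def)
  fix \<tau> assume t: "\<tau> \<in> perms n"
  have "rs \<alpha> \<star> delta \<sigma> \<star> cs \<beta> = 0" if "\<sigma> \<in> perms n" for \<sigma>
    using sandwich_vanishes[OF \<alpha> \<beta> that] dominated_if_transversal[OF \<alpha> \<beta> that] assms(3) by blast
  then show "(rs \<alpha> \<star> f \<star> cs \<beta>) \<tau> = 0 \<tau>"
    by (simp add: mult_expand[OF t])
qed simp

text \<open>This is \<open>young_symmetrizer \<alpha>\<close> with the product taken in \<open>S\<^sub>n\<close> for the fixed \<open>n\<close>; the two agree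
for partitions of \<open>n\<close>.\<close>

definition young :: "nat list \<Rightarrow> (nat \<Rightarrow> nat) \<Rightarrow> complex" where
  "young \<alpha> = rs \<alpha> \<star> cs \<alpha>"

lemma young_eq: "is_partition \<alpha> n \<Longrightarrow> young_symmetrizer \<alpha> = young \<alpha>"
  by (simp add: young_symmetrizer_def young_def is_partition_sum)

text \<open>For a group element \<open>f = \<sigma>\<close> the product is \<open>0\<close> if \<open>\<sigma>\<close> has a row/column collision, and otherwise
\<open>\<sigma>\<close> factors through the row and column groups and contributes only a sign.\<close>

lemma young_sandwich_scalar:
  assumes \<alpha>: "is_partition \<alpha> n"
  shows "\<exists>k. rs \<alpha> \<star> f \<star> cs \<alpha> = fun_scale k (young \<alpha>)"
proof -
  have "\<exists>k. rs \<alpha> \<star> delta \<sigma> \<star> cs \<alpha> = fun_scale k (young \<alpha>)" if s: "\<sigma> \<in> perms n" for \<sigma>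
  proof (cases "inj_on (\<lambda>x. (row_of \<alpha> x, col_of \<alpha> (inv \<sigma> x))) {..<n}")
    case True
    then obtain \<pi> \<kappa> where pk: "\<pi> \<in> row_group \<alpha>" "\<kappa> \<in> column_group \<alpha>" "\<sigma> = \<pi> \<circ> \<kappa>"
      by (rule transversal_factor[OF \<alpha> s])
    then have "\<pi> \<in> perms n" "\<kappa> \<in> perms n"
      using row_group_closed[OF \<alpha>] column_group_closed[OF \<alpha>] by auto
    then have "rs \<alpha> \<star> delta \<sigma> \<star> cs \<alpha> = (rs \<alpha> \<star> delta \<pi>) \<star> (delta \<kappa> \<star> cs \<alpha>)"
      by (simp add: pk(3) delta_delta[symmetric] mult_assoc)
    also have "\<dots> = fun_scale (of_int (sign \<kappa>)) (young \<alpha>)"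
      by (simp add: rs_delta[OF \<alpha> pk(1)] delta_cs[OF \<alpha> pk(2)] young_def)
    finally show ?thesis by blast
  next
    case False
    then show ?thesis
      using sandwich_vanishes[OF \<alpha> \<alpha> s] by (intro exI[of _ 0]) (simp add: fun_eq_iff fun_scale_def)
  qed
  then obtain \<phi> where \<phi>: "\<And>\<sigma>. \<sigma> \<in> perms n \<Longrightarrow> rs \<alpha> \<star> delta \<sigma> \<star> cs \<alpha> = fun_scale (\<phi> \<sigma>) (young \<alpha>)"
    by metis
  have "rs \<alpha> \<star> f \<star> cs \<alpha> = fun_scale (\<Sum>\<sigma>\<in>perms n. f \<sigma> * \<phi> \<sigma>) (young \<alpha>)"
  proof (rule ga_eqI; (simp add: young_def)?)
    fix \<tau> assume "\<tau> \<in> perms n"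
    then show "(rs \<alpha> \<star> f \<star> cs \<alpha>) \<tau> = fun_scale (\<Sum>\<sigma>\<in>perms n. f \<sigma> * \<phi> \<sigma>) (rs \<alpha> \<star> cs \<alpha>) \<tau>"
      by (simp add: mult_expand \<phi>) (simp add: fun_scale_def young_def sum_distrib_left mult_ac)
  qed
  then show ?thesis by blast
qed

lemma young_id: "is_partition \<alpha> n \<Longrightarrow> young \<alpha> id = 1"
proof -
  assume \<alpha>: "is_partition \<alpha> n"
  have "rs \<alpha> \<tau> * cs \<alpha> (inv \<tau>) = (if \<tau> = id then 1 else 0)" if "\<tau> \<in> perms n" for \<tau>
  proof (cases "\<tau> \<in> row_group \<alpha> \<and> inv \<tau> \<in> column_group \<alpha>")
    case True
    then have "inv (inv \<tau>) \<in> column_group \<alpha>" using column_group_closed(3)[OF \<alpha>] by blast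
    then have "\<tau> = id" using True that by (intro row_column_trivial[OF \<alpha>]) auto
    then show ?thesis
      by (simp add: row_symmetrizer_def column_antisymmetrizer_def row_group_closed[OF \<alpha>]
          column_group_closed[OF \<alpha>] sign_id inv_id)
  next
    case False
    then show ?thesis
      using row_group_closed(1)[OF \<alpha>] column_group_closed(1)[OF \<alpha>]
      by (auto simp: row_symmetrizer_def column_antisymmetrizer_def)
  qed
  then show "young \<alpha> id = 1" by (simp add: young_def mult_eq)
qed

lemma young_integral: "young \<alpha> \<sigma> \<in> \<int>"
  unfolding young_def by (intro integral_mult rs_integral cs_integral)

text \<open>Write \<open>a\<close>, \<open>b\<close> for the two factors of the Young symmetrizer; both are fixed by \<open>flip\<close> and are
multiples of idempotents. If \<open>abab = 0\<close>, then \<open>(aba)(aba)\<^sup>*\<close> is a multiple of \<open>ababa = 0\<close>, so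
\<open>aba = 0\<close> by positivity; then \<open>(ab)(ab)\<^sup>*\<close> is a multiple of \<open>aba = 0\<close>, so \<open>ab = 0\<close>, which
contradicts the coefficient \<open>1\<close> at the identity.\<close>

lemma young_square:
  assumes \<alpha>: "is_partition \<alpha> n"
  shows "\<exists>k. k \<noteq> 0 \<and> young \<alpha> \<star> young \<alpha> = fun_scale k (young \<alpha>)"
proof -
  let ?a = "rs \<alpha>" and ?b = "cs \<alpha>"
  obtain k where k: "young \<alpha> \<star> young \<alpha> = fun_scale k (young \<alpha>)"
    using young_sandwich_scalar[OF \<alpha>, of "?b \<star> ?a"] by (auto simp: young_def mult_assoc)
  have fl: "flip ?a = ?a" "flip ?b = ?b" by (simp_all add: flip_rs flip_cs \<alpha>)
  have 0: "fun_scale c 0 = 0" for c by (simp add: fun_eq_iff fun_scale_def)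
  have "k \<noteq> 0"
  proof
    assume "k = 0"
    then have "young \<alpha> \<star> young \<alpha> = 0" using k by (simp add: fun_eq_iff fun_scale_def)
    then have abab: "?a \<star> ?b \<star> ?a \<star> ?b = 0" by (simp add: young_def mult_assoc)
    have "(?a \<star> ?b \<star> ?a) \<star> flip (?a \<star> ?b \<star> ?a) = ?a \<star> ?b \<star> (?a \<star> ?a) \<star> ?b \<star> ?a"
      by (simp add: flip_mult fl mult_assoc)
    also have "\<dots> = fun_scale (of_nat (card (row_group \<alpha>))) (?a \<star> ?b \<star> ?a \<star> ?b \<star> ?a)"
      by (simp add: rs_rs[OF \<alpha>])
    also have "\<dots> = 0" by (simp add: abab 0)
    finally have aba: "?a \<star> ?b \<star> ?a = 0"
      by (rule mult_flip_eq_0[rotated 2]) (intro mult_in integral_mult rs_integral cs_integral)+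
    have "young \<alpha> \<star> flip (young \<alpha>) = ?a \<star> (?b \<star> ?b) \<star> ?a"
      by (simp add: young_def flip_mult fl mult_assoc)
    also have "\<dots> = fun_scale (of_nat (card (column_group \<alpha>))) (?a \<star> ?b \<star> ?a)"
      by (simp add: cs_cs[OF \<alpha>])
    also have "\<dots> = 0" by (simp add: aba 0)
    finally have "young \<alpha> = 0"
      by (rule mult_flip_eq_0[rotated 2]) (simp add: young_def, rule young_integral)
    then show False using young_id[OF \<alpha>] by simp
  qed
  then show ?thesis using k by blast
qed

text \<open>Two different partitions cannot dominate each other, so one of the two products
\<open>a\<^sub>\<alpha> \<dots> b\<^sub>\<beta>\<close> and \<open>b\<^sub>\<alpha> \<dots> a\<^sub>\<beta>\<close> vanishes; the second is the \<open>flip\<close> of a product of the first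
kind with the roles of \<open>\<alpha>\<close> and \<open>\<beta>\<close> exchanged.\<close>

lemma young_orthogonal:
  assumes \<alpha>: "is_partition \<alpha> n" and \<beta>: "is_partition \<beta> n" and "\<alpha> \<noteq> \<beta>"
  shows "young \<alpha> \<star> f \<star> young \<beta> = 0"
proof -
  have "\<not> dominated \<alpha> \<beta> \<or> \<not> dominated \<beta> \<alpha>"
    using dominated_antisym[OF \<alpha> \<beta>] assms(3) by blast
  then show ?thesis
  proof
    assume "\<not> dominated \<alpha> \<beta>"
    then have "rs \<alpha> \<star> (cs \<alpha> \<star> f \<star> rs \<beta>) \<star> cs \<beta> = 0" by (rule rs_mult_cs_eq_0[OF \<alpha> \<beta>])
    then show ?thesis by (simp add: young_def mult_assoc)
  next
    assume "\<not> dominated \<beta> \<alpha>"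
    then have "rs \<beta> \<star> flip f \<star> cs \<alpha> = 0" by (rule rs_mult_cs_eq_0[OF \<beta> \<alpha>])
    then have "flip (rs \<beta> \<star> flip f \<star> cs \<alpha>) = 0" by (simp add: flip_def fun_eq_iff)
    then have "cs \<alpha> \<star> flip (flip f) \<star> rs \<beta> = 0"
      by (simp add: flip_mult flip_rs flip_cs \<alpha> \<beta> mult_assoc)
    moreover have "g \<star> flip (flip f) = g \<star> f" for g
      by (simp add: fun_eq_iff ga_mult_def flip_def)
    ultimately have "cs \<alpha> \<star> f \<star> rs \<beta> = 0" by simp
    moreover have "young \<alpha> \<star> f \<star> young \<beta> = rs \<alpha> \<star> (cs \<alpha> \<star> f \<star> rs \<beta>) \<star> cs \<beta>"
      by (simp add: young_def mult_assoc)
    ultimately show ?thesis by simp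
  qed
qed

end

section \<open>Characters of Specht modules and row orthogonality\<close>

lemma sum_fun_apply: "(\<Sum>i\<in>I. f i) x = (\<Sum>i\<in>I. f i x :: 'b::comm_monoid_add)"
  by (induction I rule: infinite_finite_induct) auto

lemma representation_of_sum:
  assumes ind: "fun_space.independent B" and fin: "finite B"
    and b: "b \<in> B"
  shows "fun_space.representation B (\<Sum>b\<in>B. fun_scale (c b) b) b = c b"
proof -
  have sp: "fun_scale (c x) x \<in> fun_space.span B" if "x \<in> B" for x
    using that by (intro fun_space.span_scale fun_space.span_base)
  have "fun_space.representation B (\<Sum>b\<in>B. fun_scale (c b) b) b =
    (\<Sum>x\<in>B. fun_space.representation B (fun_scale (c x) x) b)"
    by (simp add: fun_space.representation_sum[OF ind sp])
  also have "\<dots> = (\<Sum>x\<in>B. if x = b then c x else 0)"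
    by (rule sum.cong)
      (simp_all add: fun_space.representation_scale[OF ind fun_space.span_base]
        fun_space.representation_basis[OF ind])
  finally show ?thesis using b fin by simp
qed

text \<open>The vectors \<open>Q x\<close> are the images of the unit vectors under a projection onto \<open>V\<close>, which
enters through the assumption \<open>frame\<close>. Expanding both sides in matrix coefficients
yields the same double sum. As the right-hand side does not mention \<open>B\<close>, this gives at once the
independence of the trace from the basis and a formula for it.\<close>

lemma basis_trace_eq:
  fixes Q :: "'a \<Rightarrow> 'a \<Rightarrow> complex" and T :: "('a \<Rightarrow> complex) \<Rightarrow> 'a \<Rightarrow> complex"
  assumes ind: "fun_space.independent B" and span: "fun_space.span B = V"
    and fin: "finite S" and Q: "\<And>x. x \<in> S \<Longrightarrow> Q x \<in> V"
    and frame: "\<And>v. v \<in> V \<Longrightarrow> v = (\<Sum>x\<in>S. fun_scale (v x) (Q x))"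
    and lin: "Vector_Spaces.linear fun_scale fun_scale T" and TV: "\<And>v. v \<in> V \<Longrightarrow> T v \<in> V"
  shows "(\<Sum>b\<in>B. fun_space.representation B (T b) b) = (\<Sum>x\<in>S. T (Q x) x)" and "finite B"
proof -
  interpret T: Vector_Spaces.linear fun_scale fun_scale T by (rule lin)
  let ?rep = "fun_space.representation B"
  have BV: "B \<subseteq> V" using fun_space.span_superset span by blast
  have "B \<subseteq> fun_space.span (Q ` S)"
  proof
    fix b assume "b \<in> B"
    then have "b = (\<Sum>x\<in>S. fun_scale (b x) (Q x))" using BV frame by blast
    also have "\<dots> \<in> fun_space.span (Q ` S)"
      by (intro fun_space.span_sum fun_space.span_scale fun_space.span_base) auto
    finally show "b \<in> fun_space.span (Q ` S)" .
  qed
  then show finB: "finite B"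
    using fun_space.independent_span_bound[OF _ ind] fin by blast
  have "(\<Sum>x\<in>S. T (Q x) x) = (\<Sum>x\<in>S. \<Sum>b\<in>B. ?rep (Q x) b * T b x)"
  proof (rule sum.cong[OF refl])
    fix x assume "x \<in> S"
    then have "Q x = (\<Sum>b\<in>B. fun_scale (?rep (Q x) b) b)"
      using fun_space.sum_representation_eq[OF ind _ finB order.refl] Q span by simp
    then have "T (Q x) = (\<Sum>b\<in>B. fun_scale (?rep (Q x) b) (T b))"
      by (metis (no_types, lifting) T.scale T.sum sum.cong)
    then show "T (Q x) x = (\<Sum>b\<in>B. ?rep (Q x) b * T b x)"
      by (simp add: sum_fun_apply fun_scale_def)
  qed
  also have "\<dots> = (\<Sum>b\<in>B. \<Sum>x\<in>S. ?rep (Q x) b * T b x)" by (rule sum.swap)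
  also have "\<dots> = (\<Sum>b\<in>B. ?rep (T b) b)"
  proof (rule sum.cong[OF refl])
    fix b assume "b \<in> B"
    then have "T b = (\<Sum>x\<in>S. fun_scale (T b x) (Q x))" using BV TV frame by blast
    then have "?rep (T b) b = ?rep (\<Sum>x\<in>S. fun_scale (T b x) (Q x)) b" by simp
    also have "\<dots> = (\<Sum>x\<in>S. ?rep (fun_scale (T b x) (Q x)) b)"
      using Q span by (subst fun_space.representation_sum[OF ind])
        (auto intro!: fun_space.span_scale)
    also have "\<dots> = (\<Sum>x\<in>S. ?rep (Q x) b * T b x)"
      using Q span by (intro sum.cong) (simp_all add: fun_space.representation_scale[OF ind])
    finally show "(\<Sum>x\<in>S. ?rep (Q x) b * T b x) = ?rep (T b) b" ..
  qed
  finally show "(\<Sum>b\<in>B. ?rep (T b) b) = (\<Sum>x\<in>S. T (Q x) x)" ..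
qed

lemma trace_on_eq:
  fixes Q :: "'a \<Rightarrow> 'a \<Rightarrow> complex" and T :: "('a \<Rightarrow> complex) \<Rightarrow> 'a \<Rightarrow> complex"
  assumes sub: "fun_space.subspace V"
    and rest: "finite S" "\<And>x. x \<in> S \<Longrightarrow> Q x \<in> V"
      "\<And>v. v \<in> V \<Longrightarrow> v = (\<Sum>x\<in>S. fun_scale (v x) (Q x))"
      "Vector_Spaces.linear fun_scale fun_scale T" "\<And>v. v \<in> V \<Longrightarrow> T v \<in> V"
  shows "trace_on V T = (\<Sum>x\<in>S. T (Q x) x)"
proof -
  define B where "B = (SOME B. fun_space.independent B \<and> fun_space.span B = V)"
  obtain B0 where "B0 \<subseteq> V" "fun_space.independent B0" "V \<subseteq> fun_space.span B0"
    by (rule fun_space.maximal_independent_subset)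
  then have "fun_space.independent B0 \<and> fun_space.span B0 = V"
    using fun_space.span_minimal[OF _ sub] by blast
  then have "fun_space.independent B \<and> fun_space.span B = V"
    unfolding B_def by (rule someI)
  then show ?thesis
    using basis_trace_eq(1)[OF _ _ rest, of B] by (simp add: trace_on_def B_def[symmetric])
qed

lemma linear_left_translate: "Vector_Spaces.linear fun_scale fun_scale (left_translate \<sigma>)"
  by unfold_locales (simp_all add: left_translate_def fun_scale_def fun_eq_iff algebra_simps)

context sym_algebra begin

text \<open>The Young symmetrizer scaled to an idempotent; by \<open>young_square\<close> the chosen factor exists.\<close>

definition idem :: "nat list \<Rightarrow> (nat \<Rightarrow> nat) \<Rightarrow> complex" where
  "idem \<alpha> = fun_scale (inverse (SOME k. k \<noteq> 0 \<and> young \<alpha> \<star> young \<alpha> = fun_scale k (young \<alpha>))) (young \<alpha>)"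

lemma idem_young:
  assumes "is_partition \<alpha> n"
  obtains k where "k \<noteq> 0" "idem \<alpha> = fun_scale (inverse k) (young \<alpha>)" "young \<alpha> = fun_scale k (idem \<alpha>)"
    "young \<alpha> \<star> young \<alpha> = fun_scale k (young \<alpha>)"
proof -
  define k where "k = (SOME k. k \<noteq> 0 \<and> young \<alpha> \<star> young \<alpha> = fun_scale k (young \<alpha>))"
  have "k \<noteq> 0 \<and> young \<alpha> \<star> young \<alpha> = fun_scale k (young \<alpha>)"
    unfolding k_def by (rule someI_ex) (rule young_square[OF assms])
  moreover have "idem \<alpha> = fun_scale (inverse k) (young \<alpha>)" by (simp add: idem_def k_def)
  moreover from calculation have "young \<alpha> = fun_scale k (idem \<alpha>)" by simp
  ultimately show ?thesis using that by blast
qed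

lemma idem_in: "idem \<alpha> \<in> group_algebra n"
  by (simp add: idem_def young_def)

lemma idem_idem:
  assumes "is_partition \<alpha> n"
  shows "idem \<alpha> \<star> idem \<alpha> = idem \<alpha>"
proof -
  obtain k where k: "k \<noteq> 0" "idem \<alpha> = fun_scale (inverse k) (young \<alpha>)"
    "young \<alpha> \<star> young \<alpha> = fun_scale k (young \<alpha>)"
    by (rule idem_young[OF assms])
  show ?thesis using k(1) by (simp add: k(2,3))
qed

lemma idem_nonzero:
  assumes "is_partition \<alpha> n"
  shows "idem \<alpha> \<noteq> 0"
proof
  assume 0: "idem \<alpha> = 0"
  obtain k where "young \<alpha> = fun_scale k (idem \<alpha>)" by (rule idem_young[OF assms])
  then have "young \<alpha> id = 0" by (simp add: 0)
  then show False using young_id[OF assms] by simp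
qed

lemma idem_orthogonal:
  "is_partition \<alpha> n \<Longrightarrow> is_partition \<beta> n \<Longrightarrow> \<alpha> \<noteq> \<beta> \<Longrightarrow> idem \<alpha> \<star> f \<star> idem \<beta> = 0"
  by (simp add: idem_def young_orthogonal)

lemma idem_sandwich:
  assumes \<alpha>: "is_partition \<alpha> n"
  shows "\<exists>k. idem \<alpha> \<star> f \<star> idem \<alpha> = fun_scale k (idem \<alpha>)"
proof -
  obtain k where k: "idem \<alpha> = fun_scale (inverse k) (young \<alpha>)" "young \<alpha> = fun_scale k (idem \<alpha>)"
    by (rule idem_young[OF \<alpha>])
  obtain l where "rs \<alpha> \<star> (cs \<alpha> \<star> f \<star> rs \<alpha>) \<star> cs \<alpha> = fun_scale l (young \<alpha>)"
    using young_sandwich_scalar[OF \<alpha>] by blast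
  then have "young \<alpha> \<star> f \<star> young \<alpha> = fun_scale l (young \<alpha>)"
    by (simp add: young_def mult_assoc)
  also have "\<dots> = fun_scale (l * k) (idem \<alpha>)"
    by (subst k(2)) simp
  finally have *: "young \<alpha> \<star> f \<star> young \<alpha> = fun_scale (l * k) (idem \<alpha>)" .
  have "idem \<alpha> \<star> f \<star> idem \<alpha> = fun_scale (inverse k * inverse k) (young \<alpha> \<star> f \<star> young \<alpha>)"
    by (subst (1 2) k(1)) simp
  then show ?thesis unfolding * by auto
qed

lemma specht_eq:
  assumes \<alpha>: "is_partition \<alpha> n"
  shows "specht_module \<alpha> = (\<lambda>f. f \<star> young \<alpha>) ` group_algebra n"
    and "specht_module \<alpha> = (\<lambda>f. f \<star> idem \<alpha>) ` group_algebra n"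
proof -
  show 1: "specht_module \<alpha> = (\<lambda>f. f \<star> young \<alpha>) ` group_algebra n"
    using \<alpha> by (simp add: specht_module_def is_partition_sum young_eq)
  obtain k where k: "idem \<alpha> = fun_scale (inverse k) (young \<alpha>)" "young \<alpha> = fun_scale k (idem \<alpha>)"
    by (rule idem_young[OF \<alpha>])
  have "f \<star> young \<alpha> = fun_scale k f \<star> idem \<alpha>" "f \<star> idem \<alpha> = fun_scale (inverse k) f \<star> young \<alpha>" for f
    using arg_cong[OF k(2), of "\<lambda>g. f \<star> g"] arg_cong[OF k(1), of "\<lambda>g. f \<star> g"] by simp_all
  then show "specht_module \<alpha> = (\<lambda>f. f \<star> idem \<alpha>) ` group_algebra n"
    unfolding 1 using scale_in by (intro equalityI subsetI; elim imageE) (metis imageI)+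
qed

lemma zero_in [simp]: "0 \<in> group_algebra n"
  by (simp add: group_algebra_def)

lemma add_in: "f \<in> group_algebra n \<Longrightarrow> g \<in> group_algebra n \<Longrightarrow> f + g \<in> group_algebra n"
  by (simp add: group_algebra_def)

lemma subspace_specht:
  assumes \<alpha>: "is_partition \<alpha> n"
  shows "fun_space.subspace (specht_module \<alpha>)"
  unfolding fun_space.subspace_def specht_eq(2)[OF \<alpha>]
proof (intro conjI ballI allI)
  show "0 \<in> (\<lambda>f. f \<star> idem \<alpha>) ` group_algebra n"
    by (rule image_eqI[of _ _ 0]) auto
next
  fix v w assume "v \<in> (\<lambda>f. f \<star> idem \<alpha>) ` group_algebra n" "w \<in> (\<lambda>f. f \<star> idem \<alpha>) ` group_algebra n"
  then show "v + w \<in> (\<lambda>f. f \<star> idem \<alpha>) ` group_algebra n"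
    by (auto simp: mult_add[symmetric] intro!: add_in)
next
  fix c v assume "v \<in> (\<lambda>f. f \<star> idem \<alpha>) ` group_algebra n"
  then show "fun_scale c v \<in> (\<lambda>f. f \<star> idem \<alpha>) ` group_algebra n"
    by (auto simp: mult_scale(1)[symmetric] simp del: mult_scale)
qed

lemma left_translate_eq:
  assumes "\<sigma> \<in> perms n" "f \<in> group_algebra n"
  shows "left_translate \<sigma> f = delta \<sigma> \<star> f"
proof (rule ga_eqI)
  show "left_translate \<sigma> f \<in> group_algebra n"
    using assms by (simp add: group_algebra_def left_translate_def)
qed (use assms in \<open>simp_all add: delta_mult left_translate_def\<close>)

lemma specht_invariant:
  assumes \<alpha>: "is_partition \<alpha> n" and "\<sigma> \<in> perms n" "v \<in> specht_module \<alpha>"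
  shows "left_translate \<sigma> v \<in> specht_module \<alpha>"
  using assms(2,3) unfolding specht_eq(2)[OF \<alpha>]
  by (auto simp: left_translate_eq mult_assoc[symmetric])

text \<open>Right multiplication by the idempotent is the projection onto the Specht module that feeds
\<open>trace_on_eq\<close>.\<close>

lemma specht_frame:
  assumes \<alpha>: "is_partition \<alpha> n" and "v \<in> specht_module \<alpha>"
  shows "v = (\<Sum>\<tau>\<in>perms n. fun_scale (v \<tau>) (delta \<tau> \<star> idem \<alpha>))"
proof
  fix \<rho>
  obtain f where f: "v = f \<star> idem \<alpha>" using assms by (auto simp: specht_eq(2)[OF \<alpha>])
  then have v: "v = v \<star> idem \<alpha>" by (simp add: mult_assoc idem_idem[OF \<alpha>])
  show "v \<rho> = (\<Sum>\<tau>\<in>perms n. fun_scale (v \<tau>) (delta \<tau> \<star> idem \<alpha>)) \<rho>"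
  proof (cases "\<rho> \<in> perms n")
    case True
    have "v \<rho> = (v \<star> idem \<alpha>) \<rho>" using v by simp
    then show ?thesis
      using True by (simp add: sum_fun_apply fun_scale_def delta_mult mult_eq[of \<rho> v])
  next
    case False
    then show ?thesis using f by (simp add: sum_fun_apply fun_scale_def mult_outside)
  qed
qed

lemma specht_frame_in:
  assumes \<alpha>: "is_partition \<alpha> n" and "\<tau> \<in> perms n"
  shows "delta \<tau> \<star> idem \<alpha> \<in> specht_module \<alpha>"
  using assms(2) unfolding specht_eq(2)[OF \<alpha>] by blast

lemma irr_char_eq:
  assumes \<alpha>: "is_partition \<alpha> n" and \<sigma>: "\<sigma> \<in> perms n"
  shows "irr_char \<alpha> \<sigma> = (\<Sum>\<tau>\<in>perms n. idem \<alpha> (inv \<tau> \<circ> inv \<sigma> \<circ> \<tau>))"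
proof -
  have "irr_char \<alpha> \<sigma> = (\<Sum>\<tau>\<in>perms n. left_translate \<sigma> (delta \<tau> \<star> idem \<alpha>) \<tau>)"
    unfolding irr_char_def
    by (rule trace_on_eq[OF subspace_specht[OF \<alpha>] finite_perms specht_frame_in[OF \<alpha>]
          specht_frame[OF \<alpha>] linear_left_translate specht_invariant[OF \<alpha> \<sigma>]])
  also have "\<dots> = (\<Sum>\<tau>\<in>perms n. idem \<alpha> (inv \<tau> \<circ> inv \<sigma> \<circ> \<tau>))"
    by (rule sum.cong) (use \<sigma> in \<open>simp_all add: left_translate_def delta_mult comp_assoc\<close>)
  finally show ?thesis .
qed

lemma irr_char_conj:
  assumes \<alpha>: "is_partition \<alpha> n" and "\<sigma> \<in> perms n" "\<rho> \<in> perms n"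
  shows "irr_char \<alpha> (\<rho> \<circ> \<sigma> \<circ> inv \<rho>) = irr_char \<alpha> \<sigma>"
proof -
  have "irr_char \<alpha> (\<rho> \<circ> \<sigma> \<circ> inv \<rho>) = (\<Sum>\<tau>\<in>perms n. idem \<alpha> (inv \<tau> \<circ> (\<rho> \<circ> inv \<sigma> \<circ> inv \<rho>) \<circ> \<tau>))"
    using assms by (simp add: irr_char_eq inv_comp comp_assoc)
  also have "\<dots> = (\<Sum>\<tau>\<in>perms n. idem \<alpha> (inv (\<rho> \<circ> \<tau>) \<circ> (\<rho> \<circ> inv \<sigma> \<circ> inv \<rho>) \<circ> (\<rho> \<circ> \<tau>)))"
    by (rule sum_perms_left[OF assms(3), symmetric])
  also have "\<dots> = irr_char \<alpha> \<sigma>"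
    using assms by (simp add: irr_char_eq inv_comp comp_assoc)
  finally show ?thesis .
qed

text \<open>Both characters are sums of coefficients of their idempotents over all conjugates. Conjugation
invariance of the second one turns the first sum into the factor \<open>n!\<close>; the other becomes a sum
of coefficients of products of the shape that Young symmetrizers control.\<close>

lemma irr_char_sandwich:
  assumes \<alpha>: "is_partition \<alpha> n" and \<beta>: "is_partition \<beta> n"
  shows "(\<Sum>\<sigma>\<in>perms n. irr_char \<alpha> \<sigma> * irr_char \<beta> (inv \<sigma>)) =
    fact n * (\<Sum>\<rho>\<in>perms n. (idem \<alpha> \<star> delta \<rho> \<star> idem \<beta>) \<rho>)"
proof -
  have "(\<Sum>\<sigma>\<in>perms n. irr_char \<alpha> \<sigma> * irr_char \<beta> (inv \<sigma>)) =
    (\<Sum>\<sigma>\<in>perms n. \<Sum>\<tau>\<in>perms n. idem \<alpha> (inv \<tau> \<circ> inv \<sigma> \<circ> \<tau>) * irr_char \<beta> (inv \<sigma>))"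
    by (rule sum.cong) (simp_all add: irr_char_eq[OF \<alpha>] sum_distrib_right)
  also have "\<dots> = (\<Sum>\<sigma>\<in>perms n. \<Sum>\<tau>\<in>perms n. idem \<alpha> (inv \<tau> \<circ> \<sigma> \<circ> \<tau>) * irr_char \<beta> \<sigma>)"
    by (subst sum_perms_inv[symmetric]) simp
  also have "\<dots> = (\<Sum>\<tau>\<in>perms n. \<Sum>\<sigma>\<in>perms n. idem \<alpha> (inv \<tau> \<circ> \<sigma> \<circ> \<tau>) * irr_char \<beta> \<sigma>)"
    by (rule sum.swap)
  also have "\<dots> = (\<Sum>\<tau>\<in>perms n. \<Sum>\<sigma>\<in>perms n. idem \<alpha> \<sigma> * irr_char \<beta> \<sigma>)"
  proof (rule sum.cong[OF refl])
    fix \<tau> assume t: "\<tau> \<in> perms n"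
    show "(\<Sum>\<sigma>\<in>perms n. idem \<alpha> (inv \<tau> \<circ> \<sigma> \<circ> \<tau>) * irr_char \<beta> \<sigma>) =
      (\<Sum>\<sigma>\<in>perms n. idem \<alpha> \<sigma> * irr_char \<beta> \<sigma>)"
      by (rule sum.reindex_bij_witness[of _ "\<lambda>\<sigma>. \<tau> \<circ> \<sigma> \<circ> inv \<tau>" "\<lambda>\<sigma>. inv \<tau> \<circ> \<sigma> \<circ> \<tau>"])
        (use t irr_char_conj[OF \<beta>, of _ "inv \<tau>"] in \<open>simp_all add: comp_assoc\<close>)
  qed
  also have "\<dots> = fact n * (\<Sum>\<sigma>\<in>perms n. idem \<alpha> \<sigma> * irr_char \<beta> \<sigma>)"
    by (simp add: card_perms)
  also have "(\<Sum>\<sigma>\<in>perms n. idem \<alpha> \<sigma> * irr_char \<beta> \<sigma>) =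
    (\<Sum>\<sigma>\<in>perms n. \<Sum>\<rho>\<in>perms n. idem \<alpha> \<sigma> * idem \<beta> (inv \<rho> \<circ> inv \<sigma> \<circ> \<rho>))"
    by (rule sum.cong) (simp_all add: irr_char_eq[OF \<beta>] sum_distrib_left)
  also have "\<dots> = (\<Sum>\<rho>\<in>perms n. \<Sum>\<sigma>\<in>perms n. idem \<alpha> \<sigma> * idem \<beta> (inv \<rho> \<circ> inv \<sigma> \<circ> \<rho>))"
    by (rule sum.swap)
  also have "\<dots> = (\<Sum>\<rho>\<in>perms n. (idem \<alpha> \<star> delta \<rho> \<star> idem \<beta>) \<rho>)"
    by (rule sum.cong) (simp_all add: mult_assoc mult_eq[of _ "idem \<alpha>"] delta_mult comp_assoc)
  finally show ?thesis .
qed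

text \<open>If \<open>e \<rho> e = \<phi>(\<rho>) e\<close>, then the sum of the preceding lemma is \<open>\<Sum>\<^sub>\<rho> \<phi>(\<rho>) e(\<rho>)\<close>, and the same sum is
the scalar by which \<open>e e e\<close> differs from \<open>e\<close>, namely \<open>1\<close>.\<close>

lemma irr_char_orthogonal:
  assumes \<alpha>: "is_partition \<alpha> n" and \<beta>: "is_partition \<beta> n"
  shows "(\<Sum>\<sigma>\<in>perms n. irr_char \<alpha> \<sigma> * irr_char \<beta> (inv \<sigma>)) = (if \<alpha> = \<beta> then fact n else 0)"
proof (cases "\<alpha> = \<beta>")
  case False
  then show ?thesis by (simp add: irr_char_sandwich \<alpha> \<beta> idem_orthogonal)
next
  case True
  have "\<forall>\<rho>. \<exists>k. idem \<alpha> \<star> delta \<rho> \<star> idem \<alpha> = fun_scale k (idem \<alpha>)"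
    using idem_sandwich[OF \<alpha>] by blast
  from choice[OF this] obtain \<phi> where
    \<phi>: "\<And>\<rho>. idem \<alpha> \<star> delta \<rho> \<star> idem \<alpha> = fun_scale (\<phi> \<rho>) (idem \<alpha>)" by blast
  define s where "s = (\<Sum>\<rho>\<in>perms n. idem \<alpha> \<rho> * \<phi> \<rho>)"
  have "idem \<alpha> = idem \<alpha> \<star> idem \<alpha> \<star> idem \<alpha>" by (simp add: idem_idem[OF \<alpha>])
  then have e: "idem \<alpha> \<tau> = s * idem \<alpha> \<tau>" if "\<tau> \<in> perms n" for \<tau>
    using mult_expand[OF that, of "idem \<alpha>" "idem \<alpha>" "idem \<alpha>"]
    by (simp add: \<phi> s_def fun_scale_def sum_distrib_right mult.assoc)
  have "s = 1"
  proof (rule ccontr)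
    assume "s \<noteq> 1"
    then have "idem \<alpha> = 0"
      using e by (intro ga_eqI idem_in) (auto simp: mult_cancel_right1)
    then show False using idem_nonzero[OF \<alpha>] by simp
  qed
  moreover have "(\<Sum>\<rho>\<in>perms n. (idem \<alpha> \<star> delta \<rho> \<star> idem \<alpha>) \<rho>) = s"
    by (simp add: \<phi> s_def) (simp add: fun_scale_def mult.commute)
  ultimately show ?thesis
    using irr_char_sandwich[OF \<alpha> \<alpha>] unfolding True[symmetric] by simp
qed

end

section \<open>Integral forms and the parity of character values\<close>

text \<open>A lattice of integer-valued functions on a finite set has a \<open>\<int>\<close>-basis that is even linearly
independent over \<open>\<complex>\<close>. The induction adds one point \<open>x\<close> of the domain at a time: a member \<open>v0\<close>
whose value at \<open>x\<close> is the smallest positive one extends a basis of the members vanishing at \<open>x\<close>,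
by division with remainder.\<close>

lemma integral_lattice_basis:
  fixes L :: "('a \<Rightarrow> complex) set"
  assumes "finite S" and "\<And>v x. v \<in> L \<Longrightarrow> x \<notin> S \<Longrightarrow> v x = 0"
    and "\<And>v x. v \<in> L \<Longrightarrow> v x \<in> \<int>"
    and "0 \<in> L" and "\<And>v w q. v \<in> L \<Longrightarrow> w \<in> L \<Longrightarrow> v + fun_scale (of_int q) w \<in> L"
  shows "\<exists>B\<subseteq>L. finite B \<and> fun_space.independent B \<and>
    (\<forall>v\<in>L. \<exists>c. (\<forall>b. c b \<in> \<int>) \<and> v = (\<Sum>b\<in>B. fun_scale (c b) b))"
  using assms
proof (induction S arbitrary: L rule: finite_induct)
  case empty
  then have 0: "v = 0" if "v \<in> L" for v using that by (auto simp: fun_eq_iff)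
  have "\<exists>c. (\<forall>b. c b \<in> \<int>) \<and> v = (\<Sum>b\<in>{}. fun_scale (c b) b)" if "v \<in> L" for v
    using 0[OF that] by (intro exI[of _ "\<lambda>b. 0"]) simp
  then show ?case
    using fun_space.independent_empty by (intro exI[of _ "{}"]) blast
next
  case (insert x S)
  note supp = insert.prems(1) and int = insert.prems(2) and zero = insert.prems(3)
    and comb = insert.prems(4)
  define L0 where "L0 = {v \<in> L. v x = 0}"
  have "\<exists>B\<subseteq>L0. finite B \<and> fun_space.independent B \<and>
    (\<forall>v\<in>L0. \<exists>c. (\<forall>b. c b \<in> \<int>) \<and> v = (\<Sum>b\<in>B. fun_scale (c b) b))"
  proof (rule insert.IH)
    show "v y = 0" if "v \<in> L0" "y \<notin> S" for v y
      using that supp[of v y] by (cases "y = x") (auto simp: L0_def)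
  qed (use int zero comb in \<open>auto simp: L0_def fun_scale_def\<close>)
  then obtain B where B: "B \<subseteq> L0" "finite B" "fun_space.independent B"
    and rep: "\<And>v. v \<in> L0 \<Longrightarrow> \<exists>c. (\<forall>b. c b \<in> \<int>) \<and> v = (\<Sum>b\<in>B. fun_scale (c b) b)"
    by blast
  show ?case
  proof (cases "L0 = L")
    case True
    then show ?thesis using B rep by blast
  next
    case False
    \<comment> \<open>the positive values at x that occur in the lattice\<close>
    let ?P = "\<lambda>d::nat. d > 0 \<and> (\<exists>v\<in>L. v x = of_nat d)"
    have "\<exists>d. ?P d"
    proof -
      obtain v where v: "v \<in> L" "v x \<noteq> 0" using False by (auto simp: L0_def)
      obtain m where m: "v x = of_int m" using int[OF v(1), of x] by (auto elim: Ints_cases)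
      \<comment> \<open>the sign makes the value at x positive\<close>
      have "fun_scale (of_int (sgn m)) v \<in> L" using comb[OF zero v(1)] by simp
      moreover have "fun_scale (of_int (sgn m)) v x = of_int \<bar>m\<bar>"
        by (simp add: fun_scale_def m of_int_mult[symmetric] sgn_mult_abs mult.commute abs_sgn
            del: of_int_mult)
      ultimately have "?P (nat \<bar>m\<bar>)" using v m by (intro conjI bexI) (auto simp del: of_int_abs)
      then show ?thesis by blast
    qed
    then have "?P (LEAST d. ?P d)" by (rule LeastI_ex)
    then obtain d v0 where d: "d = (LEAST d. ?P d)" "d > 0" and v0: "v0 \<in> L" "v0 x = of_nat d"
      by auto
    have L0: "\<exists>q::int. v - fun_scale (of_int q) v0 \<in> L0" if v: "v \<in> L" for v
    proof -
      obtain m where m: "v x = of_int m" using int[OF v, of x] by (auto elim: Ints_cases)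
      define w where "w = v - fun_scale (of_int (m div int d)) v0"
      have w: "w = v + fun_scale (of_int (- (m div int d))) v0" by (simp add: w_def)
      have wL: "w \<in> L" unfolding w by (rule comb[OF v v0(1)])
      have "w x = of_int (m - (m div int d) * int d)"
        by (simp add: w_def fun_scale_def m v0)
      also have "m - (m div int d) * int d = int (nat (m mod int d))"
        using d(2) by (simp add: minus_div_mult_eq_mod)
      finally have wx: "w x = of_nat (nat (m mod int d))" by simp
      have "nat (m mod int d) < (LEAST d. ?P d)" using d by (simp add: nat_less_iff)
      then have "\<not> ?P (nat (m mod int d))" by (rule not_less_Least)
      moreover have "?P (nat (m mod int d))" if "nat (m mod int d) > 0"
        using that wx wL by (intro conjI bexI[of _ w])
      ultimately have "\<not> nat (m mod int d) > 0" by (rule contrapos_nn)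
      then have "w x = 0" using wx by simp
      then show ?thesis using wL by (auto simp: L0_def w_def)
    qed
    have vanish: "v x = 0" if "v \<in> fun_space.span B" for v
      using that
    proof (induction rule: fun_space.span_induct_alt)
      case (step c b v)
      then show ?case using B(1) by (auto simp: L0_def fun_scale_def)
    qed simp
    have v0B: "v0 \<notin> fun_space.span B"
    proof
      assume "v0 \<in> fun_space.span B"
      then have "v0 x = 0" by (rule vanish)
      then show False using v0(2) d(2) by simp
    qed
    then have ind: "fun_space.independent (insert v0 B)"
      using B(3) by (simp add: fun_space.independent_insertI)
    have "\<exists>c. (\<forall>b. c b \<in> \<int>) \<and> v = (\<Sum>b\<in>insert v0 B. fun_scale (c b) b)" if v: "v \<in> L" for v
    proof -
      obtain q :: int where "v - fun_scale (of_int q) v0 \<in> L0" using L0[OF v] by blast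
      then obtain c where c: "\<And>b. c b \<in> \<int>" "v - fun_scale (of_int q) v0 = (\<Sum>b\<in>B. fun_scale (c b) b)"
        using rep by meson
      have nb: "v0 \<notin> B" using v0B fun_space.span_base by blast
      have "(\<Sum>b\<in>insert v0 B. fun_scale ((c(v0 := of_int q)) b) b) =
        fun_scale (of_int q) v0 + (\<Sum>b\<in>B. fun_scale ((c(v0 := of_int q)) b) b)"
        using B(2) nb by simp
      also have "(\<Sum>b\<in>B. fun_scale ((c(v0 := of_int q)) b) b) = v - fun_scale (of_int q) v0"
        unfolding c(2) by (rule sum.cong) (use nb in auto)
      finally have "v = (\<Sum>b\<in>insert v0 B. fun_scale ((c(v0 := of_int q)) b) b)" by simp
      then show ?thesis using c(1) by (intro exI[of _ "c(v0 := of_int q)"]) auto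
    qed
    then show ?thesis
      using B(1,2) ind v0 by (intro exI[of _ "insert v0 B"]) (auto simp: L0_def)
  qed
qed

text \<open>\<open>tr (M\<^sup>2) \<equiv> tr M\<close> modulo \<open>2\<close> for an integer matrix: off-diagonal products occur twice, and
\<open>t\<^sup>2 \<equiv> t\<close> on the diagonal.\<close>

lemma trace_square_parity:
  fixes m :: "'b \<Rightarrow> 'b \<Rightarrow> int"
  assumes "finite B"
  shows "even ((\<Sum>b\<in>B. \<Sum>c\<in>B. m b c * m c b) - (\<Sum>b\<in>B. m b b))"
  using assms
proof (induction B)
  case (insert x B)
  have "(\<Sum>c\<in>B. m c x * m x c) = (\<Sum>c\<in>B. m x c * m c x)" by (simp add: mult.commute)
  then have "(\<Sum>b\<in>insert x B. \<Sum>c\<in>insert x B. m b c * m c b) - (\<Sum>b\<in>insert x B. m b b) =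
    m x x * (m x x - 1) + 2 * (\<Sum>c\<in>B. m x c * m c x) +
    ((\<Sum>b\<in>B. \<Sum>c\<in>B. m b c * m c b) - (\<Sum>b\<in>B. m b b))"
    using insert.hyps by (simp add: sum.distrib algebra_simps)
  then show ?case using insert.IH by simp
qed simp

context sym_algebra begin

text \<open>Since the Young symmetrizer has integer coefficients, \<open>\<int>[S\<^sub>n] c\<^sub>\<alpha>\<close> is a lattice in the Specht
module which is stable under the group, so the group acts by integer matrices.\<close>

lemma specht_integral_basis:
  assumes \<alpha>: "is_partition \<alpha> n"
  obtains B where "finite B" "fun_space.independent B" "fun_space.span B = specht_module \<alpha>"
    "\<And>\<sigma> b b'. \<sigma> \<in> perms n \<Longrightarrow> b \<in> B \<Longrightarrow> b' \<in> B \<Longrightarrow>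
      fun_space.representation B (left_translate \<sigma> b) b' \<in> \<int>"
proof -
  define L where "L = {f \<star> young \<alpha> | f. f \<in> group_algebra n \<and> (\<forall>\<tau>. f \<tau> \<in> \<int>)}"
  have "\<exists>B\<subseteq>L. finite B \<and> fun_space.independent B \<and>
    (\<forall>v\<in>L. \<exists>c. (\<forall>b. c b \<in> \<int>) \<and> v = (\<Sum>b\<in>B. fun_scale (c b) b))"
  proof (rule integral_lattice_basis[OF finite_perms[of n]])
    show "v x = 0" if "v \<in> L" "x \<notin> perms n" for v x
    proof -
      obtain f where "v = f \<star> young \<alpha>" using \<open>v \<in> L\<close> unfolding L_def by blast
      then show ?thesis using \<open>x \<notin> perms n\<close> by (simp add: mult_outside)
    qed
    show "v x \<in> \<int>" if "v \<in> L" for v x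
    proof -
      obtain f where "v = f \<star> young \<alpha>" "\<forall>\<tau>. f \<tau> \<in> \<int>" using \<open>v \<in> L\<close> unfolding L_def by blast
      then show ?thesis by (simp add: integral_mult young_integral)
    qed
    show "0 \<in> L" unfolding L_def by (intro CollectI exI[of _ 0]) simp
    fix v w q assume "v \<in> L" "w \<in> L"
    then obtain f g where fg: "v = f \<star> young \<alpha>" "w = g \<star> young \<alpha>" "f \<in> group_algebra n"
      "g \<in> group_algebra n" "\<forall>\<tau>. f \<tau> \<in> \<int>" "\<forall>\<tau>. g \<tau> \<in> \<int>"
      by (auto simp: L_def)
    show "v + fun_scale (of_int q) w \<in> L"
      unfolding L_def
    proof (intro CollectI exI conjI)
      show "v + fun_scale (of_int q) w = (f + fun_scale (of_int q) g) \<star> young \<alpha>"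
        by (simp add: fg mult_add)
      show "f + fun_scale (of_int q) g \<in> group_algebra n"
        using fg by (intro add_in scale_in)
      show "\<forall>\<tau>. (f + fun_scale (of_int q) g) \<tau> \<in> \<int>"
        using fg by (simp add: fun_scale_def)
    qed
  qed
  then obtain B where B: "B \<subseteq> L" "finite B" "fun_space.independent B"
    and rep: "\<And>v. v \<in> L \<Longrightarrow> \<exists>c. (\<forall>b. c b \<in> \<int>) \<and> v = (\<Sum>b\<in>B. fun_scale (c b) b)"
    by blast
  have LV: "L \<subseteq> specht_module \<alpha>" by (auto simp: L_def specht_eq(1)[OF \<alpha>])
  have Lspan: "L \<subseteq> fun_space.span B"
  proof
    fix v assume "v \<in> L"
    then obtain c where "v = (\<Sum>b\<in>B. fun_scale (c b) b)" using rep by blast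
    then show "v \<in> fun_space.span B"
      by (simp only:) (rule fun_space.span_sum, rule fun_space.span_scale, rule fun_space.span_base)
  qed
  have "specht_module \<alpha> \<subseteq> fun_space.span B"
  proof
    fix v assume "v \<in> specht_module \<alpha>"
    then obtain f where f: "v = f \<star> young \<alpha>" by (auto simp: specht_eq(1)[OF \<alpha>])
    have v: "v = (\<Sum>\<tau>\<in>perms n. fun_scale (f \<tau>) (delta \<tau> \<star> young \<alpha>))"
    proof
      fix \<rho>
      show "v \<rho> = (\<Sum>\<tau>\<in>perms n. fun_scale (f \<tau>) (delta \<tau> \<star> young \<alpha>)) \<rho>"
        by (cases "\<rho> \<in> perms n")
          (simp_all add: f sum_fun_apply fun_scale_def delta_mult mult_outside, simp add: mult_eq)
    qed
    have d: "delta \<tau> \<rho> \<in> \<int>" for \<tau> \<rho> by (simp add: delta_def)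
    have "(\<Sum>\<tau>\<in>perms n. fun_scale (f \<tau>) (delta \<tau> \<star> young \<alpha>)) \<in> fun_space.span B"
    proof (intro fun_space.span_sum fun_space.span_scale)
      fix \<tau> assume "\<tau> \<in> perms n"
      then have "delta \<tau> \<star> young \<alpha> \<in> L"
        using delta_in[of \<tau>] d[of \<tau>] unfolding L_def by blast
      then show "delta \<tau> \<star> young \<alpha> \<in> fun_space.span B" using Lspan by blast
    qed
    with v show "v \<in> fun_space.span B" by simp
  qed
  moreover have "fun_space.span B \<subseteq> specht_module \<alpha>"
    using B(1) LV subspace_specht[OF \<alpha>] by (intro fun_space.span_minimal) auto
  ultimately have span: "fun_space.span B = specht_module \<alpha>" by blast
  have "fun_space.representation B (left_translate \<sigma> b) b' \<in> \<int>"
    if s: "\<sigma> \<in> perms n" and b: "b \<in> B" "b' \<in> B" for \<sigma> b b'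
  proof -
    obtain f where f: "b = f \<star> young \<alpha>" "\<forall>\<tau>. f \<tau> \<in> \<int>" using b B(1) by (auto simp: L_def)
    have "left_translate \<sigma> b = delta \<sigma> \<star> f \<star> young \<alpha>"
      by (simp add: f left_translate_eq[OF s] mult_assoc)
    moreover have "(delta \<sigma> \<star> f) \<tau> \<in> \<int>" for \<tau>
      using f(2) by (intro integral_mult) (auto simp: delta_def)
    ultimately have "left_translate \<sigma> b \<in> L" unfolding L_def by blast
    then obtain c where c: "\<forall>b. c b \<in> \<int>" "left_translate \<sigma> b = (\<Sum>b\<in>B. fun_scale (c b) b)"
      using rep by blast
    then show ?thesis using representation_of_sum[OF B(3,2) b(2)] by simp
  qed
  then show ?thesis using that B span by blast
qed

lemma irr_char_integral_square:
  assumes \<alpha>: "is_partition \<alpha> n" and \<sigma>: "\<sigma> \<in> perms n"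
  obtains k l :: int where "irr_char \<alpha> \<sigma> = of_int k" "irr_char \<alpha> (\<sigma> \<circ> \<sigma>) = of_int l" "even (k - l)"
proof -
  obtain B where B: "finite B" "fun_space.independent B" "fun_space.span B = specht_module \<alpha>"
    and int: "\<And>\<sigma> b b'. \<sigma> \<in> perms n \<Longrightarrow> b \<in> B \<Longrightarrow> b' \<in> B \<Longrightarrow>
      fun_space.representation B (left_translate \<sigma> b) b' \<in> \<int>"
    using specht_integral_basis[OF \<alpha>] by blast
  let ?rep = "fun_space.representation B" and ?T = "left_translate \<sigma>"
  interpret T: Vector_Spaces.linear fun_scale fun_scale ?T by (rule linear_left_translate)
  have tr: "irr_char \<alpha> \<rho> = (\<Sum>b\<in>B. ?rep (left_translate \<rho> b) b)" if r: "\<rho> \<in> perms n" for \<rho>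
    unfolding irr_char_def
    using trace_on_eq[OF subspace_specht[OF \<alpha>] finite_perms specht_frame_in[OF \<alpha>]
          specht_frame[OF \<alpha>] linear_left_translate specht_invariant[OF \<alpha> r]]
      basis_trace_eq(1)[OF B(2,3) finite_perms specht_frame_in[OF \<alpha>]
          specht_frame[OF \<alpha>] linear_left_translate specht_invariant[OF \<alpha> r]]
    by simp
  define m where "m b c = \<lfloor>Re (?rep (?T b) c)\<rfloor>" for b c
  have m: "?rep (?T b) c = of_int (m b c)" if "b \<in> B" "c \<in> B" for b c
    using int[OF \<sigma> that] by (auto simp: m_def elim!: Ints_cases)
  have TV: "?T b \<in> fun_space.span B" if "b \<in> B" for b
    using specht_invariant[OF \<alpha> \<sigma>] that fun_space.span_base[OF that] B(3) by simp
  have 1: "irr_char \<alpha> \<sigma> = of_int (\<Sum>b\<in>B. m b b)"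
    by (simp add: tr[OF \<sigma>] m)
  have "left_translate (\<sigma> \<circ> \<sigma>) b = ?T (?T b)" for b
    using \<sigma> by (simp add: left_translate_def inv_comp comp_assoc)
  then have "irr_char \<alpha> (\<sigma> \<circ> \<sigma>) = (\<Sum>b\<in>B. ?rep (?T (?T b)) b)"
    using \<sigma> by (simp add: tr)
  also have "\<dots> = (\<Sum>b\<in>B. \<Sum>c\<in>B. of_int (m b c * m c b))"
  proof (rule sum.cong[OF refl])
    fix b assume b: "b \<in> B"
    have "?T b = (\<Sum>c\<in>B. fun_scale (?rep (?T b) c) c)"
      using fun_space.sum_representation_eq[OF B(2) TV[OF b] B(1) order.refl] by simp
    then have "?T (?T b) = ?T (\<Sum>c\<in>B. fun_scale (?rep (?T b) c) c)" by simp
    also have "\<dots> = (\<Sum>c\<in>B. fun_scale (?rep (?T b) c) (?T c))"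
      by (simp add: T.sum T.scale)
    finally have "?rep (?T (?T b)) b = (\<Sum>c\<in>B. ?rep (fun_scale (?rep (?T b) c) (?T c)) b)"
      by (simp add: fun_space.representation_sum[OF B(2)] fun_space.span_scale TV)
    also have "\<dots> = (\<Sum>c\<in>B. of_int (m b c * m c b))"
      by (rule sum.cong) (simp_all add: fun_space.representation_scale[OF B(2)] TV m b)
    finally show "?rep (?T (?T b)) b = (\<Sum>c\<in>B. of_int (m b c * m c b))" .
  qed
  finally have 2: "irr_char \<alpha> (\<sigma> \<circ> \<sigma>) = of_int (\<Sum>b\<in>B. \<Sum>c\<in>B. m b c * m c b)" by simp
  show ?thesis
    using that[OF 1 2] trace_square_parity[OF B(1), of m] by (simp add: even_diff_iff)
qed

end

section \<open>Cycles, conjugacy and merging of cycles\<close>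

lemma perms_permutation: "g \<in> perms n \<Longrightarrow> permutation g"
  by (auto simp: perms_def permutation_permutes)

lemma perms_self_orbit: "g \<in> perms n \<Longrightarrow> x \<in> orbit g x"
  by (intro permutation_self_in_orbit perms_permutation)

lemma perms_orbit_eq: "g \<in> perms n \<Longrightarrow> y \<in> orbit g x \<Longrightarrow> orbit g y = orbit g x"
  by (rule orbit_cyclic_eq3[OF cyclic_on_orbit'[OF perms_permutation]])

lemma perms_orbit_subset: "g \<in> perms n \<Longrightarrow> x < n \<Longrightarrow> orbit g x \<subseteq> {..<n}"
  unfolding perms_def using permutes_orbit_subset[of g "{..<n}" x] by simp

lemma perms_orbit_finite: "g \<in> perms n \<Longrightarrow> finite (orbit g x)"
  by (intro finite_orbit perms_self_orbit)

lemma perms_orbit_card_pos: "g \<in> perms n \<Longrightarrow> card (orbit g x) > 0"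
  using perms_orbit_finite perms_self_orbit by (metis card_gt_0_iff empty_iff)

lemma perms_orbit_funpow: "g \<in> perms n \<Longrightarrow> orbit g x = {(g ^^ i) x | i. True}"
  by (rule orbit_altdef_permutation[OF perms_permutation])

lemma perms_fix: "g \<in> perms n \<Longrightarrow> \<not> x < n \<Longrightarrow> g x = x"
  unfolding perms_def using permutes_not_in[of g "{..<n}" x] by simp

lemma perms_step_orbit_iff: "g \<in> perms n \<Longrightarrow> g z \<in> orbit g x \<longleftrightarrow> z \<in> orbit g x"
  using orbit.step cyclic_on_f_in[of g "{..<n}" "orbit g x" z] cyclic_on_orbit'[OF perms_permutation]
  by (auto simp: perms_def)

lemma permsI:
  assumes "\<And>x y. x < n \<Longrightarrow> y < n \<Longrightarrow> h x = h y \<Longrightarrow> x = y" "\<And>x. x < n \<Longrightarrow> h x < n"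
    "\<And>x. \<not> x < n \<Longrightarrow> h x = x"
  shows "h \<in> perms n"
  unfolding perms_def mem_Collect_eq
proof (rule inj_imp_permutes)
  show "inj_on h {..<n}" by (rule inj_onI) (simp add: assms(1))
qed (simp_all add: assms(2,3))

lemma funpow_eq_iff_mod:
  assumes g: "g \<in> perms n"
  shows "(g ^^ i) x = (g ^^ j) x \<longleftrightarrow> i mod card (orbit g x) = j mod card (orbit g x)"
proof -
  define d where "d = funpow_dist1 g x x"
  note self = perms_self_orbit[OF g, of x]
  have inj: "inj_on (\<lambda>n. (g ^^ n) x) {0..<d}"
    unfolding d_def by (rule inj_on_funpow_dist1[OF self])
  have "card (orbit g x) = d"
    using orbit_conv_funpow_dist1[OF self] card_image[OF inj] by (simp add: d_def)
  moreover have period: "(g ^^ d) x = x"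
    unfolding d_def by (rule funpow_dist1_prop[OF self])
  moreover have "d > 0" by (simp add: d_def)
  moreover have "(g ^^ i) x = (g ^^ j) x \<longleftrightarrow> (g ^^ (i mod d)) x = (g ^^ (j mod d)) x"
    by (simp add: funpow_mod_eq[OF period])
  ultimately show ?thesis
    using inj_on_eq_iff[OF inj, of "i mod d" "j mod d"] by simp
qed

text \<open>Two cycles of equal length are isomorphic as dynamical systems. The lemma serves twice: it
conjugates permutations of the same cycle type, and it links two cycles of one permutation into
a cycle of double length.\<close>

lemma orbit_intertwiner:
  assumes g: "g \<in> perms n" and h: "h \<in> perms k" and card: "card (orbit g x) = card (orbit h y)"
  obtains \<theta> where "bij_betw \<theta> (orbit g x) (orbit h y)" "\<theta> x = y"
    "\<And>z. z \<in> orbit g x \<Longrightarrow> \<theta> (g z) = h (\<theta> z)"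
proof -
  define \<theta> where "\<theta> z = (h ^^ (SOME i. (g ^^ i) x = z)) y" for z
  have \<theta>: "\<theta> ((g ^^ i) x) = (h ^^ i) y" for i
  proof -
    define j where "j = (SOME j. (g ^^ j) x = (g ^^ i) x)"
    have "(g ^^ j) x = (g ^^ i) x" unfolding j_def by (rule someI[of _ i]) simp
    then have "(h ^^ j) y = (h ^^ i) y"
      by (simp add: funpow_eq_iff_mod[OF g] funpow_eq_iff_mod[OF h] card)
    then show ?thesis by (simp add: \<theta>_def j_def)
  qed
  have "bij_betw \<theta> (orbit g x) (orbit h y)"
    unfolding bij_betw_def
  proof
    show "inj_on \<theta> (orbit g x)"
    proof (rule inj_onI)
      fix u v assume "u \<in> orbit g x" "v \<in> orbit g x" "\<theta> u = \<theta> v"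
      moreover from calculation obtain i j where "u = (g ^^ i) x" "v = (g ^^ j) x"
        unfolding perms_orbit_funpow[OF g] by blast
      ultimately show "u = v"
        by (simp add: \<theta> funpow_eq_iff_mod[OF g] funpow_eq_iff_mod[OF h] card)
    qed
    show "\<theta> ` orbit g x = orbit h y"
      by (auto simp: perms_orbit_funpow[OF g] perms_orbit_funpow[OF h] \<theta> image_iff) (metis \<theta>)
  qed
  moreover have "\<theta> x = y" using \<theta>[of 0] by simp
  moreover have "\<theta> (g z) = h (\<theta> z)" if z: "z \<in> orbit g x" for z
  proof -
    obtain i where "z = (g ^^ i) x" using z by (auto simp: perms_orbit_funpow[OF g])
    then show ?thesis using \<theta>[of i] \<theta>[of "Suc i"] by simp
  qed
  ultimately show ?thesis using that by blast
qed

lemma count_cycle_type: "count (cycle_type n g) s = card {C \<in> orbit g ` {..<n}. card C = s}"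
proof -
  have "{C. C \<in> orbit g ` {..<n} \<and> s = card C} = {C \<in> orbit g ` {..<n}. card C = s}" by auto
  then show ?thesis
    by (simp add: cycle_type_def count_image_mset')
qed

lemma card_points_in_cycles:
  assumes g: "g \<in> perms n"
  shows "card {x. x < n \<and> card (orbit g x) = s} = s * count (cycle_type n g) s"
proof -
  let ?X = "{x. x < n \<and> card (orbit g x) = s}" and ?A = "{C \<in> orbit g ` {..<n}. card C = s}"
  have "(\<Sum>C\<in>?A. \<Sum>x\<in>{x \<in> ?X. orbit g x = C}. 1) = (\<Sum>x\<in>?X. 1::nat)"
    by (rule sum.group) auto
  moreover have "{x \<in> ?X. orbit g x = C} = C" if C: "C \<in> ?A" for C
  proof -
    obtain y where y: "C = orbit g y" "y < n" "card C = s" using C by auto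
    then show ?thesis
      using perms_orbit_eq[OF g] perms_self_orbit[OF g] perms_orbit_subset[OF g, of y] by auto
  qed
  ultimately have "card ?X = (\<Sum>C\<in>?A. card C)" by simp
  then show ?thesis by (simp add: count_cycle_type mult.commute)
qed

text \<open>Used to match the cycles of two permutations of the same cycle type by length.\<close>

lemma bij_of_equal_counts:
  fixes f :: "'a \<Rightarrow> 'c" and g :: "'b \<Rightarrow> 'c"
  assumes "finite A" "finite B"
    and eq: "image_mset f (mset_set A) = image_mset g (mset_set B)"
  obtains F where "bij_betw F A B" "\<And>a. a \<in> A \<Longrightarrow> g (F a) = f a"
proof -
  have "card {a \<in> A. f a = s} = card {b \<in> B. g b = s}" for s
  proof -
    have "count (image_mset f (mset_set A)) s = count (image_mset g (mset_set B)) s"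
      by (simp add: eq)
    moreover have "{x. x \<in> A \<and> s = f x} = {a \<in> A. f a = s}" "{x. x \<in> B \<and> s = g x} = {b \<in> B. g b = s}"
      by auto
    ultimately show ?thesis using assms(1,2) by (simp add: count_image_mset')
  qed
  then have "\<exists>\<phi>. bij_betw \<phi> {a \<in> A. f a = s} {b \<in> B. g b = s}" for s
    using assms by (intro finite_same_card_bij) auto
  then obtain \<phi> where \<phi>: "\<And>s. bij_betw (\<phi> s) {a \<in> A. f a = s} {b \<in> B. g b = s}" by metis
  define F where "F a = \<phi> (f a) a" for a
  have FB: "F a \<in> B \<and> g (F a) = f a" if "a \<in> A" for a
    using bij_betwE[OF \<phi>[of "f a"]] that by (auto simp: F_def)
  moreover have "bij_betw F A B"
    unfolding bij_betw_def
  proof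
    show "inj_on F A"
    proof (rule inj_onI)
      fix a b assume ab: "a \<in> A" "b \<in> A" "F a = F b"
      then have "f a = f b" using FB by metis
      then show "a = b"
        using bij_betw_imp_inj_on[OF \<phi>[of "f a"]] ab by (auto simp: F_def inj_on_def)
    qed
    show "F ` A = B"
    proof (intro equalityI subsetI)
      fix b assume "b \<in> B"
      then have "b \<in> \<phi> (g b) ` {a \<in> A. f a = g b}"
        using bij_betw_imp_surj_on[OF \<phi>[of "g b"]] by simp
      then obtain a where "a \<in> A" "f a = g b" "b = \<phi> (g b) a" by blast
      then show "b \<in> F ` A" by (intro image_eqI[of _ _ a]) (simp_all add: F_def)
    qed (use FB in auto)
  qed
  ultimately show ?thesis using that by blast
qed

lemma conjugate_if_same_cycle_type:
  assumes g: "g \<in> perms n" and h: "h \<in> perms n" and eq: "cycle_type n g = cycle_type n h"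
  obtains \<rho> where "\<rho> \<in> perms n" "h = \<rho> \<circ> g \<circ> inv \<rho>"
proof -
  let ?A = "orbit g ` {..<n}" and ?B = "orbit h ` {..<n}"
  obtain F where F: "bij_betw F ?A ?B" "\<And>C. C \<in> ?A \<Longrightarrow> card (F C) = card C"
    by (rule bij_of_equal_counts[of ?A ?B card card]) (use eq in \<open>auto simp: cycle_type_def\<close>)
  have "\<exists>\<theta>. bij_betw \<theta> C (F C) \<and> (\<forall>z\<in>C. \<theta> (g z) = h (\<theta> z))" if C: "C \<in> ?A" for C
  proof -
    obtain x where x: "C = orbit g x" using C by blast
    have "F C \<in> ?B" using bij_betwE[OF F(1)] C by blast
    then obtain y where y: "F C = orbit h y" by blast
    have "card (orbit g x) = card (orbit h y)" using F(2)[OF C] x y by simp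
    then show ?thesis using orbit_intertwiner[OF g h] x y by metis
  qed
  then obtain \<theta> where \<theta>: "\<And>C. C \<in> ?A \<Longrightarrow> bij_betw (\<theta> C) C (F C)"
    "\<And>C z. C \<in> ?A \<Longrightarrow> z \<in> C \<Longrightarrow> \<theta> C (g z) = h (\<theta> C z)" by metis
  define \<rho> where "\<rho> x = (if x < n then \<theta> (orbit g x) x else x)" for x
  have \<rho>F: "\<rho> x \<in> F (orbit g x)" if "x < n" for x
    using bij_betwE[OF \<theta>(1)] perms_self_orbit[OF g] that by (auto simp: \<rho>_def)
  have FB: "F (orbit g x) \<in> ?B" if "x < n" for x
    using bij_betwE[OF F(1)] that by blast
  have "\<rho> \<in> perms n"
  proof (rule permsI)
    fix x assume x: "x < n"
    obtain y where "F (orbit g x) = orbit h y" "y < n" using FB[OF x] by auto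
    then show "\<rho> x < n" using \<rho>F[OF x] perms_orbit_subset[OF h, of y] by auto
  next
    fix x y assume xy: "x < n" "y < n" "\<rho> x = \<rho> y"
    obtain u v where uv: "F (orbit g x) = orbit h u" "F (orbit g y) = orbit h v"
      using FB[OF xy(1)] FB[OF xy(2)] by auto
    have "\<rho> x \<in> orbit h u" "\<rho> x \<in> orbit h v" using \<rho>F[OF xy(1)] \<rho>F[OF xy(2)] xy uv by auto
    then have "orbit h u = orbit h v" using perms_orbit_eq[OF h] by metis
    then have "F (orbit g x) = F (orbit g y)" using uv by simp
    then have o: "orbit g x = orbit g y"
      using bij_betw_imp_inj_on[OF F(1)] xy by (auto simp: inj_on_def)
    then have "\<theta> (orbit g x) x = \<theta> (orbit g x) y" using xy by (simp add: \<rho>_def)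
    moreover have "x \<in> orbit g x" "y \<in> orbit g x" using perms_self_orbit[OF g] o by auto
    ultimately show "x = y"
      using bij_betw_imp_inj_on[OF \<theta>(1)[of "orbit g x"]] xy by (auto simp: inj_on_def)
  qed (simp add: \<rho>_def)
  moreover have "\<rho> (g x) = h (\<rho> x)" for x
  proof (cases "x < n")
    case True
    have "orbit g (g x) = orbit g x" by (rule perms_orbit_eq[OF g orbit.base])
    then show ?thesis
      using True \<theta>(2)[of "orbit g x" x] perms_self_orbit[OF g, of x] perms_less[OF g, of x]
      by (simp add: \<rho>_def)
  next
    case False
    then show ?thesis using perms_fix[OF g False] perms_fix[OF h False] by (simp add: \<rho>_def)
  qed
  then have "\<rho> \<circ> g = h \<circ> \<rho>" by (simp add: fun_eq_iff)
  then have "h = \<rho> \<circ> g \<circ> inv \<rho>" using perms_group(6)[OF calculation, of h] by simp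
  ultimately show ?thesis by (rule that)
qed

text \<open>The permutation \<open>h\<close> with its action on a single orbit \<open>C\<close> replaced by the \<open>s\<close>-th power. Ordinary
powers do not suffice, because the other cycles have to stay as they are.\<close>

definition local_power :: "nat \<Rightarrow> nat set \<Rightarrow> (nat \<Rightarrow> nat) \<Rightarrow> nat \<Rightarrow> nat" where
  "local_power s C h = (\<lambda>z. if z \<in> C then (h ^^ s) z else h z)"

lemma funpow_orbit_iff:
  assumes "h \<in> perms n"
  shows "(h ^^ s) z \<in> orbit h x \<longleftrightarrow> z \<in> orbit h x"
  by (induction s) (auto simp: perms_step_orbit_iff[OF assms])

lemma perms_funpow: "h \<in> perms n \<Longrightarrow> h ^^ s \<in> perms n"
  by (induction s) (simp_all only: funpow.simps perms_closed)

lemma local_power_perms: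
  assumes h: "h \<in> perms n"
  shows "local_power s (orbit h x) h \<in> perms n"
proof (rule permsI)
  show "local_power s (orbit h x) h y < n" if "y < n" for y
    using that perms_less[OF h] perms_less[OF perms_funpow[OF h]] by (simp add: local_power_def)
  have mem: "local_power s (orbit h x) h w \<in> orbit h x \<longleftrightarrow> w \<in> orbit h x" for w
    by (simp add: local_power_def funpow_orbit_iff[OF h] perms_step_orbit_iff[OF h])
  show "y = z" if eq: "local_power s (orbit h x) h y = local_power s (orbit h x) h z" for y z
  proof (cases "y \<in> orbit h x")
    case True
    then have "z \<in> orbit h x" using mem[of y] mem[of z] eq by simp
    then show ?thesis
      using True eq by (simp add: local_power_def perms_inj[OF perms_funpow[OF h]])
  next
    case False
    then have "z \<notin> orbit h x" using mem[of y] mem[of z] eq by simp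
    then show ?thesis
      using False eq by (simp add: local_power_def perms_inj[OF h])
  qed
  show "local_power s (orbit h x) h y = y" if "\<not> y < n" for y
    using perms_fix[OF h that] perms_fix[OF perms_funpow[OF h] that] by (simp add: local_power_def)
qed

lemma local_power_funpow:
  assumes h: "h \<in> perms n"
  shows "(local_power s (orbit h x) h ^^ N) z = (if z \<in> orbit h x then (h ^^ (s * N)) z else (h ^^ N) z)"
proof (induction N)
  case (Suc N)
  then show ?case
    by (simp add: local_power_def funpow_orbit_iff[OF h] funpow_add)
qed simp

text \<open>A power coprime to the length of a cycle generates the same cyclic group there.\<close>

lemma orbit_local_power_coprime:
  assumes h: "h \<in> perms n" and cop: "coprime s (card (orbit h x))" and s: "s > 0"
  shows "orbit (local_power s (orbit h x) h) z = orbit h z"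
proof -
  let ?k = "local_power s (orbit h x) h"
  have k: "?k \<in> perms n" by (rule local_power_perms[OF h])
  have to_k: "\<exists>N. (h ^^ i) z = (?k ^^ N) z" for i
  proof (cases "z \<in> orbit h x")
    case True
    \<comment> \<open>Bezout: u is an inverse of s modulo the length of the orbit\<close>
    obtain u v where uv: "s * u = card (orbit h x) * v + gcd s (card (orbit h x))"
      using bezout_nat[of s "card (orbit h x)"] s by blast
    then have "s * u = card (orbit h x) * v + 1" using cop by simp
    then have "s * (u * i) = card (orbit h x) * (v * i) + i"
      by (metis (no_types, lifting) add_mult_distrib mult.assoc nat_mult_1)
    then have "(s * (u * i)) mod card (orbit h x) = i mod card (orbit h x)" by simp
    then have "(h ^^ (s * (u * i))) z = (h ^^ i) z"
      using perms_orbit_eq[OF h True] by (simp add: funpow_eq_iff_mod[OF h])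
    then show ?thesis using True by (intro exI[of _ "u * i"]) (simp add: local_power_funpow[OF h])
  qed (auto simp: local_power_funpow[OF h])
  have to_h: "\<exists>i. (?k ^^ N) z = (h ^^ i) z" for N
    unfolding local_power_funpow[OF h] by auto
  show ?thesis
  proof (intro equalityI subsetI)
    fix w assume "w \<in> orbit ?k z"
    then obtain N where "w = (?k ^^ N) z" unfolding perms_orbit_funpow[OF k] by blast
    then show "w \<in> orbit h z" using to_h[of N] by (simp add: perms_orbit_funpow[OF h])
  next
    fix w assume "w \<in> orbit h z"
    then obtain i where "w = (h ^^ i) z" unfolding perms_orbit_funpow[OF h] by blast
    then show "w \<in> orbit ?k z" using to_k[of i] by (simp add: perms_orbit_funpow[OF k])
  qed
qed

lemma cycle_type_local_power_coprime:
  assumes "h \<in> perms n" "coprime s (card (orbit h x))" "s > 0"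
  shows "cycle_type n (local_power s (orbit h x) h) = cycle_type n h"
  by (simp add: cycle_type_def orbit_local_power_coprime[OF assms, abs_def])

lemma cycle_type_inv:
  assumes "h \<in> perms n"
  shows "cycle_type n (inv h) = cycle_type n h"
  by (simp add: cycle_type_def orbit_inv_eq[OF perms_permutation[OF assms], abs_def])

text \<open>The permutation \<open>h\<close> goes from the orbit of \<open>x\<close> to that of \<open>y\<close> by an intertwiner \<open>\<theta>\<close>, and back by
\<open>g \<circ> \<theta>\<^sup>-\<^sup>1\<close>. It is thus a square root of \<open>g\<close> on the two orbits, which it joins to one cycle of
length \<open>2a\<close>. Recording \<open>g\<close> as a local square and \<open>y\<close> as \<open>h x\<close> makes the construction injective,
which is what the counting argument below uses.\<close>

lemma merge_orbits:
  assumes g: "g \<in> perms n" and xy: "x < n" "y < n" "y \<notin> orbit g x"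
    and card: "card (orbit g x) = a" "card (orbit g y) = a"
  obtains h where "h \<in> perms n" "orbit h x = orbit g x \<union> orbit g y" "card (orbit h x) = 2 * a"
    "h x = y" "g = local_power 2 (orbit h x) h"
    "cycle_type n h + {#a, a#} = cycle_type n g + {#2 * a#}"
proof -
  let ?X = "orbit g x" and ?Y = "orbit g y"
  obtain \<theta> where \<theta>: "bij_betw \<theta> ?X ?Y" "\<theta> x = y" "\<And>z. z \<in> ?X \<Longrightarrow> \<theta> (g z) = g (\<theta> z)"
    by (rule orbit_intertwiner[OF g g, of x y]) (use card in auto)
  have disj: "?X \<inter> ?Y = {}"
  proof (rule ccontr)
    assume "?X \<inter> ?Y \<noteq> {}"
    then obtain z where "z \<in> ?X" "z \<in> ?Y" by blast
    then have "?X = ?Y" using perms_orbit_eq[OF g] by metis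
    then show False using xy(3) perms_self_orbit[OF g, of y] by simp
  qed
  define \<eta> where "\<eta> = inv_into ?X \<theta>"
  have \<eta>: "\<eta> z \<in> ?X" "\<theta> (\<eta> z) = z" if "z \<in> ?Y" for z
    using that bij_betw_imp_surj_on[OF \<theta>(1)] unfolding \<eta>_def
    by (metis inv_into_into, metis f_inv_into_f)
  have \<eta>\<theta>: "\<eta> (\<theta> z) = z" if "z \<in> ?X" for z
    using that bij_betw_imp_inj_on[OF \<theta>(1)] by (simp add: \<eta>_def)
  have \<theta>Y: "\<theta> z \<in> ?Y" if "z \<in> ?X" for z using bij_betwE[OF \<theta>(1)] that by blast
  define h where "h z = (if z \<in> ?X then \<theta> z else if z \<in> ?Y then g (\<eta> z) else g z)" for z
  have hX: "h z = \<theta> z" if "z \<in> ?X" for z using that by (simp add: h_def)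
  have hY: "h z = g (\<eta> z)" if "z \<in> ?Y" for z using that disj by (auto simp: h_def)
  have hO: "h z = g z" if "z \<notin> ?X \<union> ?Y" for z using that by (simp add: h_def)
  have gX: "g z \<in> ?X \<longleftrightarrow> z \<in> ?X" and gY: "g z \<in> ?Y \<longleftrightarrow> z \<in> ?Y" for z
    by (simp_all add: perms_step_orbit_iff[OF g])
  have hh: "h (h z) = g z" if "z \<in> ?X \<union> ?Y" for z
  proof (cases "z \<in> ?X")
    case True
    then show ?thesis using hX hY \<theta>Y \<eta>\<theta> by simp
  next
    case False
    then have "z \<in> ?Y" using that by simp
    then show ?thesis using hX hY \<eta> gX \<theta>(3) by simp
  qed
  have hin: "h z \<in> ?X \<union> ?Y \<longleftrightarrow> z \<in> ?X \<union> ?Y" for z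
  proof (cases "z \<in> ?X \<union> ?Y")
    case True
    then show ?thesis using hX hY \<theta>Y \<eta> gX by auto
  next
    case False
    then show ?thesis using hO[OF False] gX gY by simp
  qed
  have sub: "?X \<subseteq> {..<n}" "?Y \<subseteq> {..<n}" using perms_orbit_subset[OF g] xy by auto
  have h: "h \<in> perms n"
  proof (rule permsI)
    fix z assume z: "z < n"
    show "h z < n"
    proof (cases "z \<in> ?X \<union> ?Y")
      case True
      then have "h z \<in> ?X \<union> ?Y" using hin by blast
      then show ?thesis using sub by auto
    next
      case False
      then show ?thesis using hO[OF False] z perms_less[OF g] by simp
    qed
  next
    fix z w assume eq: "h z = h w"
    show "z = w"
    proof (cases "z \<in> ?X \<union> ?Y")
      case True
      then have w: "w \<in> ?X \<union> ?Y" using hin[of z] hin[of w] eq by simp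
      have "g z = g w" using hh[OF True] hh[OF w] eq by simp
      then show ?thesis by (simp add: perms_inj[OF g])
    next
      case False
      then have w: "w \<notin> ?X \<union> ?Y" using hin[of z] hin[of w] eq by simp
      have "g z = g w" using hO[OF False] hO[OF w] eq by simp
      then show ?thesis by (simp add: perms_inj[OF g])
    qed
  next
    fix z assume z: "\<not> z < n"
    then have "z \<notin> ?X \<union> ?Y" using sub by auto
    then show "h z = z" using hO perms_fix[OF g z] by simp
  qed
  have funX: "(g ^^ i) x = (h ^^ (2 * i)) x" for i
  proof (induction i)
    case (Suc i)
    have "(g ^^ i) x \<in> ?X" by (auto simp: perms_orbit_funpow[OF g])
    then show ?case using Suc hh by simp
  qed simp
  have orb: "orbit h x = ?X \<union> ?Y"
  proof
    show "orbit h x \<subseteq> ?X \<union> ?Y"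
    proof
      fix z assume "z \<in> orbit h x"
      then show "z \<in> ?X \<union> ?Y"
        by induction (use hin perms_self_orbit[OF g, of x] in blast)+
    qed
    have X: "?X \<subseteq> orbit h x"
      unfolding perms_orbit_funpow[OF g] perms_orbit_funpow[OF h] using funX by auto
    moreover have "?Y \<subseteq> orbit h x"
    proof
      fix z assume z: "z \<in> ?Y"
      then have "\<eta> z \<in> orbit h x" using \<eta> X by blast
      then have "h (\<eta> z) \<in> orbit h x" by (rule orbit.step)
      then show "z \<in> orbit h x" using hX \<eta> z by simp
    qed
    ultimately show "?X \<union> ?Y \<subseteq> orbit h x" by blast
  qed
  have cardO: "card (orbit h x) = 2 * a"
    using card disj by (simp add: orb card_Un_disjoint perms_orbit_finite[OF g])
  have pow: "g = local_power 2 (orbit h x) h"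
  proof
    fix z show "g z = local_power 2 (orbit h x) h z"
      using hh[of z] hO[of z] by (auto simp: local_power_def orb numeral_2_eq_2)
  qed
  define R where "R = orbit g ` ({..<n} - (?X \<union> ?Y))"
  have out: "orbit h z = orbit g z" if z: "z \<notin> ?X \<union> ?Y" for z
  proof (rule orbit_cong[OF perms_self_orbit[OF g]])
    fix w assume w: "w \<in> orbit g z"
    have "w \<notin> ?X \<union> ?Y"
    proof
      assume "w \<in> ?X \<union> ?Y"
      then have "orbit g w = ?X \<or> orbit g w = ?Y" using perms_orbit_eq[OF g] by blast
      moreover have "orbit g w = orbit g z" by (rule perms_orbit_eq[OF g w])
      ultimately show False using z perms_self_orbit[OF g, of z] by auto
    qed
    then show "h w = g w" by (rule hO)
  qed
  \<comment> \<open>the orbits outside the two merged ones are common to g and h\<close>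
  have split: "{..<n} = ({..<n} - (?X \<union> ?Y)) \<union> (?X \<union> ?Y)" using sub by blast
  have "orbit g ` (?X \<union> ?Y) = {?X, ?Y}"
    using perms_orbit_eq[OF g] perms_self_orbit[OF g] by (auto simp: image_iff)
  then have Ag: "orbit g ` {..<n} = insert ?X (insert ?Y R)"
    by (subst split, subst image_Un) (auto simp: R_def)
  have "orbit h ` (?X \<union> ?Y) = {?X \<union> ?Y}"
    using perms_orbit_eq[OF h] perms_self_orbit[OF g, of x] orb by (auto simp: image_iff)
  moreover have "orbit h ` ({..<n} - (?X \<union> ?Y)) = R"
    unfolding R_def by (rule image_cong) (use out in auto)
  ultimately have Ah: "orbit h ` {..<n} = insert (?X \<union> ?Y) R"
    by (subst split, subst image_Un) auto
  have notR: "C \<inter> (?X \<union> ?Y) = {} \<and> C \<noteq> {}" if "C \<in> R" for C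
  proof -
    obtain z where z: "C = orbit g z" "z \<notin> ?X \<union> ?Y" using \<open>C \<in> R\<close> by (auto simp: R_def)
    have "w \<notin> ?X \<union> ?Y" if w: "w \<in> C" for w
    proof
      assume "w \<in> ?X \<union> ?Y"
      then have "orbit g w = ?X \<or> orbit g w = ?Y" using perms_orbit_eq[OF g] by blast
      moreover have "orbit g w = orbit g z" using w unfolding z(1) by (rule perms_orbit_eq[OF g])
      ultimately show False using z(2) perms_self_orbit[OF g, of z] by auto
    qed
    then have "C \<inter> (?X \<union> ?Y) = {}" by blast
    then show ?thesis using orbit_nonempty[of g z] z(1) by simp
  qed
  have ne: "?X \<noteq> {}" "?Y \<noteq> {}" by (auto simp: orbit_nonempty)
  have "?X \<notin> R" "?Y \<notin> R" "?X \<union> ?Y \<notin> R" using notR ne by blast+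
  moreover have "?X \<noteq> ?Y" using disj ne by blast
  moreover have "finite R" by (simp add: R_def)
  ultimately have "cycle_type n h + {#a, a#} = cycle_type n g + {#2 * a#}"
    using card cardO by (simp add: cycle_type_def Ag Ah orb)
  moreover have "h x = y" using hX[OF perms_self_orbit[OF g]] \<theta>(2) by simp
  ultimately show ?thesis by (intro that[OF h orb cardO _ pow])
qed

text \<open>Double counting. Each element of the class of \<open>g\<close> has \<open>am(am - a)\<close> pairs \<open>(x, y)\<close> of points on
different cycles of length \<open>a\<close>. Merging these two cycles to \<open>h\<close> and remembering \<open>x\<close> loses nothing,
since \<open>h\<close> and \<open>x\<close> determine the element and \<open>y\<close>; and \<open>x\<close> is one of the points of \<open>h\<close> on cycles of
length \<open>2a\<close>.\<close>

lemma merge_count: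
  assumes g: "g \<in> perms n" and a: "a > 0"
    and T: "T + {#a, a#} = cycle_type n g + {#2 * a#}"
  defines "K \<equiv> {\<sigma> \<in> perms n. cycle_type n \<sigma> = cycle_type n g}"
    and "H \<equiv> {\<sigma> \<in> perms n. cycle_type n \<sigma> = T}"
    and "m \<equiv> count (cycle_type n g) a"
  shows "card K * (a * m * (a * m - a)) \<le> card H * (2 * a * count T (2 * a))"
proof -
  define P where "P \<sigma> = (SIGMA x:{x. x < n \<and> card (orbit \<sigma> x) = a}.
      {y. y < n \<and> card (orbit \<sigma> y) = a} - orbit \<sigma> x)" for \<sigma>
  define Q where "Q \<tau> = {x. x < n \<and> card (orbit \<tau> x) = 2 * a}" for \<tau>
  have cardP: "card (P \<sigma>) = a * m * (a * m - a)" if \<sigma>: "\<sigma> \<in> K" for \<sigma>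
  proof -
    have s: "\<sigma> \<in> perms n" "cycle_type n \<sigma> = cycle_type n g" using \<sigma> by (auto simp: K_def)
    let ?X = "{x. x < n \<and> card (orbit \<sigma> x) = a}"
    have X: "card ?X = a * m" using card_points_in_cycles[OF s(1), of a] by (simp add: m_def s(2))
    have "card (?X - orbit \<sigma> x) = a * m - a" if x: "x \<in> ?X" for x
    proof -
      have "orbit \<sigma> x \<subseteq> ?X"
        using perms_orbit_subset[OF s(1), of x] perms_orbit_eq[OF s(1), of _ x] x by auto
      then show ?thesis using X x perms_orbit_finite[OF s(1)] by (simp add: card_Diff_subset)
    qed
    then have "card (P \<sigma>) = (\<Sum>x\<in>?X. a * m - a)" unfolding P_def by (subst card_SigmaI) auto
    then show ?thesis using X by simp
  qed
  have cardQ: "card (Q \<tau>) = 2 * a * count T (2 * a)" if "\<tau> \<in> H" for \<tau>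
    using card_points_in_cycles[of \<tau> n "2 * a"] that by (auto simp: Q_def H_def)
  have fin: "finite K" "finite H" by (auto simp: K_def H_def)
  have "\<exists>h. h \<in> H \<and> x \<in> Q h \<and> h x = y \<and> \<sigma> = local_power 2 (orbit h x) h"
    if "\<sigma> \<in> K" "(x, y) \<in> P \<sigma>" for \<sigma> x y
  proof -
    have s: "\<sigma> \<in> perms n" "cycle_type n \<sigma> = cycle_type n g" using that by (auto simp: K_def)
    have xy: "x < n" "y < n" "y \<notin> orbit \<sigma> x" "card (orbit \<sigma> x) = a" "card (orbit \<sigma> y) = a"
      using that(2) by (auto simp: P_def)
    obtain h where h: "h \<in> perms n" "card (orbit h x) = 2 * a" "h x = y"
      "\<sigma> = local_power 2 (orbit h x) h" "cycle_type n h + {#a, a#} = cycle_type n \<sigma> + {#2 * a#}"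
      by (rule merge_orbits[OF s(1) xy])
    have "cycle_type n h + {#a, a#} = T + {#a, a#}" unfolding h(5) T s(2) ..
    then have "cycle_type n h = T" by simp
    then show ?thesis using h xy by (auto simp: H_def Q_def)
  qed
  then obtain F where F: "\<And>\<sigma> x y. \<sigma> \<in> K \<Longrightarrow> (x, y) \<in> P \<sigma> \<Longrightarrow> F \<sigma> x y \<in> H \<and> x \<in> Q (F \<sigma> x y) \<and>
      F \<sigma> x y x = y \<and> \<sigma> = local_power 2 (orbit (F \<sigma> x y) x) (F \<sigma> x y)"
    by metis
  have "card (SIGMA \<sigma>:K. P \<sigma>) \<le> card (SIGMA \<tau>:H. Q \<tau>)"
  proof (rule card_inj_on_le[of "\<lambda>(\<sigma>, x, y). (F \<sigma> x y, x)"])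
    show "inj_on (\<lambda>(\<sigma>, x, y). (F \<sigma> x y, x)) (SIGMA \<sigma>:K. P \<sigma>)"
    proof (rule inj_onI)
      fix p q
      assume pq: "p \<in> (SIGMA \<sigma>:K. P \<sigma>)" "q \<in> (SIGMA \<sigma>:K. P \<sigma>)"
        "(\<lambda>(\<sigma>, x, y). (F \<sigma> x y, x)) p = (\<lambda>(\<sigma>, x, y). (F \<sigma> x y, x)) q"
      obtain \<sigma> x y \<sigma>' x' y' where eq: "p = (\<sigma>, x, y)" "q = (\<sigma>', x', y')" by (metis prod.exhaust)
      then have "\<sigma> \<in> K" "(x, y) \<in> P \<sigma>" "\<sigma>' \<in> K" "(x', y') \<in> P \<sigma>'" "F \<sigma> x y = F \<sigma>' x' y'" "x = x'"
        using pq by auto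
      then have "\<sigma> = \<sigma>'" "y = y'" using F[of \<sigma> x y] F[of \<sigma>' x' y'] by metis+
      then show "p = q" using eq \<open>x = x'\<close> by simp
    qed
    show "(\<lambda>(\<sigma>, x, y). (F \<sigma> x y, x)) ` (SIGMA \<sigma>:K. P \<sigma>) \<subseteq> (SIGMA \<tau>:H. Q \<tau>)"
      using F by auto
    show "finite (SIGMA \<tau>:H. Q \<tau>)" using fin by (auto simp: Q_def)
  qed
  moreover have "card (SIGMA \<sigma>:K. P \<sigma>) = card K * (a * m * (a * m - a))"
    using fin cardP by (subst card_SigmaI) (auto simp: P_def)
  moreover have "card (SIGMA \<tau>:H. Q \<tau>) = card H * (2 * a * count T (2 * a))"
    using fin cardQ by (subst card_SigmaI) (auto simp: Q_def)
  ultimately show ?thesis by simp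
qed

section \<open>Column orthogonality\<close>

lemma length_le_sum_list: "0 \<notin> set \<alpha> \<Longrightarrow> length \<alpha> \<le> sum_list (\<alpha> :: nat list)"
  by (induction \<alpha>) auto

lemma finite_partitions: "finite {\<alpha>. is_partition \<alpha> n}"
proof (rule finite_subset)
  show "{\<alpha>. is_partition \<alpha> n} \<subseteq> {\<alpha>. set \<alpha> \<subseteq> {..n} \<and> length \<alpha> \<le> n}"
    using length_le_sum_list by (auto simp: is_partition_def member_le_sum_list)
  show "finite {\<alpha>. set \<alpha> \<subseteq> {..n} \<and> length \<alpha> \<le> n}"
    by (rule finite_lists_length_le) simp
qed

lemma partition_eq_if_mset_eq:
  assumes "is_partition \<alpha> n" "is_partition \<beta> n" "mset \<alpha> = mset \<beta>"
  shows "\<alpha> = \<beta>"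
proof -
  have "sorted (rev \<alpha>)" "sorted (rev \<beta>)"
    using assms(1,2) by (simp_all add: is_partition_def sorted_wrt_rev)
  then have "rev \<alpha> = rev \<beta>" using assms(3) by (metis mset_rev properties_for_sort)
  then show ?thesis by simp
qed

lemma sum_cycle_type:
  assumes g: "g \<in> perms n"
  shows "\<Sum>\<^sub># (cycle_type n g) = n"
proof -
  let ?A = "orbit g ` {..<n}"
  have "(\<Sum>C\<in>?A. \<Sum>x\<in>{x \<in> {..<n}. orbit g x = C}. 1) = (\<Sum>x\<in>{..<n}. 1::nat)"
    by (rule sum.group) auto
  moreover have "{x \<in> {..<n}. orbit g x = C} = C" if C: "C \<in> ?A" for C
  proof -
    obtain y where y: "C = orbit g y" "y < n" using C by auto
    then show ?thesis
      using perms_orbit_eq[OF g] perms_self_orbit[OF g] perms_orbit_subset[OF g, of y] by auto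
  qed
  ultimately have "(\<Sum>C\<in>?A. card C) = n" by simp
  then show ?thesis by (simp add: cycle_type_def sum_unfold_sum_mset)
qed

text \<open>With \<open>conjugate_if_same_cycle_type\<close> this bounds the number of conjugacy classes by the number of
partitions, which makes the orthogonal family of characters complete.\<close>

lemma cycle_type_partition:
  assumes g: "g \<in> perms n"
  obtains \<beta> where "is_partition \<beta> n" "mset \<beta> = cycle_type n g"
proof
  let ?\<beta> = "rev (sorted_list_of_multiset (cycle_type n g))"
  show m: "mset ?\<beta> = cycle_type n g" by simp
  have "0 \<notin># cycle_type n g"
    using perms_orbit_card_pos[OF g] by (auto simp: cycle_type_def) (metis less_irrefl)
  then have "0 \<notin> set ?\<beta>" by simp
  moreover have "sum_list ?\<beta> = n"
    by (simp only: sum_mset_sum_list[symmetric] m sum_cycle_type[OF g])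
  moreover have "sorted_wrt (\<ge>) ?\<beta>"
    by (simp add: sorted_wrt_rev)
  ultimately show "is_partition ?\<beta> n" by (simp add: is_partition_def)
qed

context sym_algebra begin

lemma irr_char_cycle_type:
  assumes "is_partition \<alpha> n" "g \<in> perms n" "h \<in> perms n" "cycle_type n g = cycle_type n h"
  shows "irr_char \<alpha> g = irr_char \<alpha> h"
proof -
  obtain \<rho> where \<rho>: "\<rho> \<in> perms n" "h = \<rho> \<circ> g \<circ> inv \<rho>"
    by (rule conjugate_if_same_cycle_type[OF assms(2-4)])
  show ?thesis unfolding \<rho>(2) using irr_char_conj[OF assms(1,2) \<rho>(1)] by simp
qed

text \<open>The value outside \<open>perms n\<close> is set to \<open>0\<close>, so that linear relations between characters as
functions on the whole type are relations on \<open>S\<^sub>n\<close>.\<close>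

definition class_char :: "nat list \<Rightarrow> (nat \<Rightarrow> nat) \<Rightarrow> complex" where
  "class_char \<alpha> \<sigma> = (if \<sigma> \<in> perms n then irr_char \<alpha> \<sigma> else 0)"

definition class_indicator :: "nat multiset \<Rightarrow> (nat \<Rightarrow> nat) \<Rightarrow> complex" where
  "class_indicator \<kappa> \<sigma> = (if \<sigma> \<in> perms n \<and> cycle_type n \<sigma> = \<kappa> then 1 else 0)"

definition partitions :: "nat list set" where
  "partitions = {\<alpha>. is_partition \<alpha> n}"

lemma finite_index: "finite partitions"
  by (simp add: partitions_def finite_partitions)

lemma class_char_coefficient:
  assumes \<beta>: "\<beta> \<in> partitions" and v: "v = (\<Sum>\<alpha>\<in>partitions. fun_scale (c \<alpha>) (class_char \<alpha>))"
  shows "(\<Sum>\<sigma>\<in>perms n. v \<sigma> * class_char \<beta> (inv \<sigma>)) = fact n * c \<beta>"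
proof -
  have "(\<Sum>\<sigma>\<in>perms n. v \<sigma> * class_char \<beta> (inv \<sigma>)) =
    (\<Sum>\<sigma>\<in>perms n. \<Sum>\<alpha>\<in>partitions. c \<alpha> * (irr_char \<alpha> \<sigma> * irr_char \<beta> (inv \<sigma>)))"
    by (rule sum.cong)
      (simp_all add: v sum_fun_apply fun_scale_def class_char_def sum_distrib_right mult.assoc)
  also have "\<dots> = (\<Sum>\<alpha>\<in>partitions. \<Sum>\<sigma>\<in>perms n. c \<alpha> * (irr_char \<alpha> \<sigma> * irr_char \<beta> (inv \<sigma>)))"
    by (rule sum.swap)
  also have "\<dots> = (\<Sum>\<alpha>\<in>partitions. if \<alpha> = \<beta> then c \<alpha> * fact n else 0)"
    by (rule sum.cong)
      (use \<beta> in \<open>simp_all add: sum_distrib_left[symmetric] irr_char_orthogonal partitions_def\<close>)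
  also have "\<dots> = fact n * c \<beta>" using \<beta> finite_index by simp
  finally show ?thesis .
qed

lemma class_char_inj: "inj_on class_char partitions"
proof (rule inj_onI, rule ccontr)
  fix \<alpha> \<beta> assume ab: "\<alpha> \<in> partitions" "\<beta> \<in> partitions" "class_char \<alpha> = class_char \<beta>" "\<alpha> \<noteq> \<beta>"
  have "(\<Sum>\<sigma>\<in>perms n. irr_char \<alpha> \<sigma> * irr_char \<alpha> (inv \<sigma>)) =
    (\<Sum>\<sigma>\<in>perms n. class_char \<beta> \<sigma> * class_char \<alpha> (inv \<sigma>))"
    unfolding ab(3)[symmetric] by (rule sum.cong) (simp_all add: class_char_def)
  also have "\<dots> = (\<Sum>\<sigma>\<in>perms n. irr_char \<beta> \<sigma> * irr_char \<alpha> (inv \<sigma>))"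
    by (rule sum.cong) (simp_all add: class_char_def)
  finally show False using ab by (simp add: irr_char_orthogonal partitions_def)
qed

lemma class_char_independent: "fun_space.independent (class_char ` partitions)"
proof (rule fun_space.independent_if_scalars_zero)
  show "finite (class_char ` partitions)" using finite_index by simp
  fix f x assume 0: "(\<Sum>x\<in>class_char ` partitions. fun_scale (f x) x) = 0" "x \<in> class_char ` partitions"
  then obtain \<beta> where \<beta>: "\<beta> \<in> partitions" "x = class_char \<beta>" by blast
  have "0 = (\<Sum>\<alpha>\<in>partitions. fun_scale (f (class_char \<alpha>)) (class_char \<alpha>))"
    using 0(1) by (simp add: sum.reindex[OF class_char_inj])
  from class_char_coefficient[OF \<beta>(1) this] show "f x = 0" using \<beta>(2) by simp
qed

lemma class_char_span:
  assumes \<alpha>: "\<alpha> \<in> partitions"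
  shows "class_char \<alpha> \<in> fun_space.span (class_indicator ` cycle_type n ` perms n)"
proof -
  define \<phi> where "\<phi> \<kappa> = irr_char \<alpha> (SOME \<sigma>. \<sigma> \<in> perms n \<and> cycle_type n \<sigma> = \<kappa>)" for \<kappa>
  have \<phi>: "irr_char \<alpha> \<sigma> = \<phi> (cycle_type n \<sigma>)" if s: "\<sigma> \<in> perms n" for \<sigma>
  proof -
    let ?\<tau> = "SOME \<tau>. \<tau> \<in> perms n \<and> cycle_type n \<tau> = cycle_type n \<sigma>"
    have "?\<tau> \<in> perms n \<and> cycle_type n ?\<tau> = cycle_type n \<sigma>"
      by (rule someI[of _ \<sigma>]) (simp add: s)
    then show ?thesis
      unfolding \<phi>_def using irr_char_cycle_type[of \<alpha> \<sigma> ?\<tau>] \<alpha> s by (simp add: partitions_def)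
  qed
  have fin: "finite (cycle_type n ` perms n)" by simp
  have "class_char \<alpha> = (\<Sum>\<kappa>\<in>cycle_type n ` perms n. fun_scale (\<phi> \<kappa>) (class_indicator \<kappa>))"
  proof
    fix \<sigma>
    show "class_char \<alpha> \<sigma> = (\<Sum>\<kappa>\<in>cycle_type n ` perms n. fun_scale (\<phi> \<kappa>) (class_indicator \<kappa>)) \<sigma>"
    proof (cases "\<sigma> \<in> perms n")
      case True
      have "(\<Sum>\<kappa>\<in>cycle_type n ` perms n. \<phi> \<kappa> * class_indicator \<kappa> \<sigma>) =
        (\<Sum>\<kappa>\<in>cycle_type n ` perms n. if \<kappa> = cycle_type n \<sigma> then \<phi> \<kappa> else 0)"
        by (rule sum.cong) (use True in \<open>auto simp: class_indicator_def\<close>)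
      also have "\<dots> = \<phi> (cycle_type n \<sigma>)" using fin True by simp
      finally show ?thesis
        using True \<phi>[OF True] by (simp add: sum_fun_apply fun_scale_def class_char_def)
    qed (simp add: sum_fun_apply fun_scale_def class_char_def class_indicator_def)
  qed
  also have "\<dots> \<in> fun_space.span (class_indicator ` cycle_type n ` perms n)"
    by (intro fun_space.span_sum, intro fun_space.span_scale, intro fun_space.span_base) blast
  finally show ?thesis .
qed

lemma cycle_types_subset: "cycle_type n ` perms n \<subseteq> mset ` partitions"
  using cycle_type_partition by (auto simp: partitions_def) (metis CollectI imageI)

lemma card_mset_partitions: "card (mset ` partitions) = card partitions"
  using partition_eq_if_mset_eq by (intro card_image inj_onI) (auto simp: partitions_def)

lemma card_class_chars: "card (class_char ` partitions) = card partitions"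
  by (rule card_image[OF class_char_inj])

lemma card_indicators: "card (class_indicator ` cycle_type n ` perms n) \<le> card (cycle_type n ` perms n)"
  by (intro card_image_le) simp

text \<open>The characters are as many independent functions as there are partitions, inside the span of the
indicators of the cycle types. So every partition is the cycle type of some permutation: the
existence of class representatives comes for free.\<close>

lemma cycle_types_eq: "cycle_type n ` perms n = mset ` partitions"
proof (rule card_subset_eq[OF _ cycle_types_subset])
  show "finite (mset ` partitions)" using finite_index by simp
  then have "card (cycle_type n ` perms n) \<le> card partitions"
    using card_mono[OF _ cycle_types_subset] card_mset_partitions by simp
  moreover have "card partitions \<le> card (class_indicator ` cycle_type n ` perms n)"
    using fun_space.independent_span_bound[OF _ class_char_independent,
        of "class_indicator ` cycle_type n ` perms n"] class_char_span
    by (auto simp: card_class_chars)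
  ultimately show "card (cycle_type n ` perms n) = card (mset ` partitions)"
    using card_indicators card_mset_partitions by simp
qed

lemma cycle_type_exists:
  assumes "is_partition \<beta> n"
  obtains \<sigma> where "\<sigma> \<in> perms n" "cycle_type n \<sigma> = mset \<beta>"
proof -
  have "mset \<beta> \<in> cycle_type n ` perms n"
    unfolding cycle_types_eq using assms by (simp add: partitions_def)
  then show ?thesis using that by auto
qed

text \<open>Otherwise the characters and this indicator would be more independent functions than there are
cycle types to span them.\<close>

lemma class_indicator_expansion:
  assumes "g \<in> perms n"
  obtains c where "class_indicator (cycle_type n g) = (\<Sum>\<alpha>\<in>partitions. fun_scale (c \<alpha>) (class_char \<alpha>))"
proof -
  let ?S = "class_char ` partitions" and ?I = "class_indicator (cycle_type n g)"
  have "?I \<in> fun_space.span ?S"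
  proof (rule ccontr)
    assume I: "?I \<notin> fun_space.span ?S"
    then have ind: "fun_space.independent (insert ?I ?S)"
      by (rule fun_space.independent_insertI[OF _ class_char_independent])
    have "insert ?I ?S \<subseteq> fun_space.span (class_indicator ` cycle_type n ` perms n)"
      (is "_ \<subseteq> ?T")
    proof (rule insert_subsetI)
      show "?I \<in> ?T" by (intro fun_space.span_base imageI assms)
      show "?S \<subseteq> ?T" by (rule image_subsetI) (rule class_char_span)
    qed
    from fun_space.independent_span_bound[OF _ ind this]
    have "card (insert ?I ?S) \<le> card (class_indicator ` cycle_type n ` perms n)" by simp
    also have "\<dots> \<le> card partitions"
      using card_indicators cycle_types_eq card_mset_partitions by simp
    finally have "card (insert ?I ?S) \<le> card ?S" by (simp add: card_class_chars)
    moreover have "?I \<notin> ?S" using I fun_space.span_base by blast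
    ultimately show False using finite_index by simp
  qed
  then obtain u where "?I = (\<Sum>v\<in>?S. fun_scale (u v) v)"
    using fun_space.span_finite[of ?S] finite_index by auto
  then have "?I = (\<Sum>\<alpha>\<in>partitions. fun_scale (u (class_char \<alpha>)) (class_char \<alpha>))"
    by (simp add: sum.reindex[OF class_char_inj])
  then show ?thesis by (rule that)
qed

text \<open>The coefficients of the class indicator in the basis of characters are given by row
orthogonality; evaluating the expansion at \<open>g\<close> gives the claim. The factor \<open>\<chi>(g\<^sup>-\<^sup>1)\<close> that
appears equals \<open>\<chi>(g)\<close> because \<open>g\<close> and its inverse have the same cycle type.\<close>

lemma column_orthogonality:
  assumes g: "g \<in> perms n"
  shows "(\<Sum>\<alpha>\<in>partitions. (irr_char \<alpha> g)\<^sup>2) * of_nat (card {\<sigma> \<in> perms n. cycle_type n \<sigma> = cycle_type n g}) = fact n"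
proof -
  let ?K = "{\<sigma> \<in> perms n. cycle_type n \<sigma> = cycle_type n g}"
  obtain c where c: "class_indicator (cycle_type n g) = (\<Sum>\<alpha>\<in>partitions. fun_scale (c \<alpha>) (class_char \<alpha>))"
    by (rule class_indicator_expansion[OF g])
  have c_eq: "fact n * c \<beta> = of_nat (card ?K) * irr_char \<beta> g" if \<beta>: "\<beta> \<in> partitions" for \<beta>
  proof -
    have "fact n * c \<beta> = (\<Sum>\<sigma>\<in>perms n. class_indicator (cycle_type n g) \<sigma> * class_char \<beta> (inv \<sigma>))"
      by (rule class_char_coefficient[OF \<beta> c, symmetric])
    also have "\<dots> = (\<Sum>\<sigma>\<in>perms n. if cycle_type n \<sigma> = cycle_type n g then irr_char \<beta> g else 0)"
    proof (rule sum.cong[OF refl])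
      fix \<sigma> assume s: "\<sigma> \<in> perms n"
      have "irr_char \<beta> (inv \<sigma>) = irr_char \<beta> g" if "cycle_type n \<sigma> = cycle_type n g"
        using irr_char_cycle_type[of \<beta> "inv \<sigma>" g] \<beta> s g that
        by (simp add: partitions_def cycle_type_inv)
      then show "class_indicator (cycle_type n g) \<sigma> * class_char \<beta> (inv \<sigma>) =
          (if cycle_type n \<sigma> = cycle_type n g then irr_char \<beta> g else 0)"
        using s by (simp add: class_indicator_def class_char_def)
    qed
    also have "\<dots> = of_nat (card ?K) * irr_char \<beta> g"
      by (simp add: sum.If_cases Int_def)
    finally show ?thesis .
  qed
  have "1 = class_indicator (cycle_type n g) g" using g by (simp add: class_indicator_def)
  also have "\<dots> = (\<Sum>\<alpha>\<in>partitions. c \<alpha> * irr_char \<alpha> g)"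
    unfolding c using g by (simp add: sum_fun_apply fun_scale_def class_char_def)
  finally have "fact n = (\<Sum>\<alpha>\<in>partitions. fact n * c \<alpha> * irr_char \<alpha> g)"
    by (simp add: sum_distrib_left[symmetric] mult.assoc)
  also have "\<dots> = (\<Sum>\<alpha>\<in>partitions. of_nat (card ?K) * (irr_char \<alpha> g)\<^sup>2)"
    by (rule sum.cong) (simp_all add: c_eq power2_eq_square)
  finally show ?thesis by (simp add: sum_distrib_right mult.commute)
qed

section \<open>Parity under merging and sign elements\<close>

definition char_int :: "nat list \<Rightarrow> (nat \<Rightarrow> nat) \<Rightarrow> int" where
  "char_int \<alpha> \<sigma> = \<lfloor>Re (irr_char \<alpha> \<sigma>)\<rfloor>"

lemma irr_char_int:
  assumes "\<alpha> \<in> partitions" "\<sigma> \<in> perms n"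
  shows "irr_char \<alpha> \<sigma> = of_int (char_int \<alpha> \<sigma>)"
proof -
  have \<alpha>: "is_partition \<alpha> n" using assms(1) by (simp add: partitions_def)
  obtain k :: int where "irr_char \<alpha> \<sigma> = of_int k"
    by (rule irr_char_integral_square[OF \<alpha> assms(2)])
  then show ?thesis by (simp add: char_int_def)
qed

lemma char_int_square:
  assumes "\<alpha> \<in> partitions" "\<sigma> \<in> perms n"
  shows "even (char_int \<alpha> (\<sigma> \<circ> \<sigma>)) \<longleftrightarrow> even (char_int \<alpha> \<sigma>)"
proof -
  have \<alpha>: "is_partition \<alpha> n" using assms(1) by (simp add: partitions_def)
  obtain k l :: int where "irr_char \<alpha> \<sigma> = of_int k" "irr_char \<alpha> (\<sigma> \<circ> \<sigma>) = of_int l" "even (k - l)"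
    by (rule irr_char_integral_square[OF \<alpha> assms(2)])
  then show ?thesis by (simp add: char_int_def) 
qed

lemma char_int_power:
  assumes "\<alpha> \<in> partitions" "\<sigma> \<in> perms n"
  shows "even (char_int \<alpha> (\<sigma> ^^ (2 ^ j))) \<longleftrightarrow> even (char_int \<alpha> \<sigma>)"
proof (induction j)
  case (Suc j)
  have "\<sigma> ^^ (2 ^ Suc j) = (\<sigma> ^^ (2 ^ j)) \<circ> (\<sigma> ^^ (2 ^ j))"
    by (simp add: funpow_add[symmetric] mult_2)
  then show ?case using char_int_square[OF assms(1) perms_funpow[OF assms(2)]] Suc by metis
qed simp

lemma even_odd_decomposition:
  assumes "(b::nat) > 0"
  obtains j m where "b = 2 ^ j * m" "odd m"
proof -
  have "\<exists>j m. b = 2 ^ j * m \<and> odd m" using assms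
  proof (induction b rule: less_induct)
    case (less b)
    show ?case
    proof (cases "even b")
      case True
      then obtain c where c: "b = 2 * c" by blast
      then obtain j m where "c = 2 ^ j * m" "odd m" using less.IH[of c] less.prems by auto
      then show ?thesis using c by (intro exI[of _ "Suc j"] exI[of _ m]) simp
    next
      case False
      then show ?thesis by (intro exI[of _ 0] exI[of _ b]) simp
    qed
  qed
  then show ?thesis using that by blast
qed

text \<open>Let the orbit have length \<open>2\<^sup>j m\<close> with \<open>m\<close> odd. Passing from \<open>h\<close> to its local power with
exponent \<open>2 + m\<close> does not change the cycle type, as \<open>2 + m\<close> is coprime to the length. After
raising to the power \<open>2\<^sup>j\<close>, the exponents \<open>2 + m\<close> and \<open>2\<close> agree on the orbit, and raising
to a power of two preserves parity.\<close>

lemma char_int_local_square: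
  assumes \<alpha>: "\<alpha> \<in> partitions" and h: "h \<in> perms n"
  shows "even (char_int \<alpha> (local_power 2 (orbit h x) h)) \<longleftrightarrow> even (char_int \<alpha> h)"
proof -
  let ?C = "orbit h x"
  obtain j m where jm: "card ?C = 2 ^ j * m" "odd m"
    using even_odd_decomposition[OF perms_orbit_card_pos[OF h]] by metis
  have "coprime (2 + m) (2 ^ j * m)"
  proof -
    have "coprime (2 + m) 2" using jm(2) by simp
    moreover have "coprime 2 m" using jm(2) by simp
    then have "coprime (2 + m) m" by (simp only: coprime_iff_gcd_eq_1 gcd_add1)
    ultimately show ?thesis by simp
  qed
  then have "cycle_type n (local_power (2 + m) ?C h) = cycle_type n h"
    by (intro cycle_type_local_power_coprime[OF h]) (simp_all add: jm(1))
  then have "irr_char \<alpha> (local_power (2 + m) ?C h) = irr_char \<alpha> h"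
    using \<alpha> by (intro irr_char_cycle_type local_power_perms h) (simp_all add: partitions_def)
  then have 1: "char_int \<alpha> (local_power (2 + m) ?C h) = char_int \<alpha> h" by (simp add: char_int_def)
  have "local_power (2 + m) ?C h ^^ (2 ^ j) = local_power 2 ?C h ^^ (2 ^ j)"
  proof
    fix z
    have "(h ^^ ((2 + m) * 2 ^ j)) z = (h ^^ (2 * 2 ^ j)) z" if "z \<in> ?C"
    proof -
      have "card (orbit h z) = 2 ^ j * m" using perms_orbit_eq[OF h that] jm(1) by simp
      moreover have "(2 + m) * 2 ^ j = 2 * 2 ^ j + 2 ^ j * m" by (simp add: algebra_simps)
      ultimately show ?thesis by (simp only: funpow_eq_iff_mod[OF h] mod_add_self2)
    qed
    then show "(local_power (2 + m) ?C h ^^ (2 ^ j)) z = (local_power 2 ?C h ^^ (2 ^ j)) z"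
      by (simp add: local_power_funpow[OF h])
  qed
  then show ?thesis
    using char_int_power[OF \<alpha> local_power_perms[OF h, of "2 + m" x], of j]
      char_int_power[OF \<alpha> local_power_perms[OF h, of 2 x], of j] 1 by simp
qed

text \<open>Sign partitions are handled through a representative of their class, since merging cycles is an
operation on permutations.\<close>

definition sign_element :: "(nat \<Rightarrow> nat) \<Rightarrow> bool" where
  "sign_element g \<longleftrightarrow> g \<in> perms n \<and> (\<forall>\<alpha>\<in>partitions. irr_char \<alpha> g \<in> {0, 1, -1})"

lemma column_orthogonality_int:
  assumes "g \<in> perms n"
  shows "(\<Sum>\<alpha>\<in>partitions. (char_int \<alpha> g)\<^sup>2) * int (card {\<sigma> \<in> perms n. cycle_type n \<sigma> = cycle_type n g}) = fact n"
proof -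
  have "of_int ((\<Sum>\<alpha>\<in>partitions. (char_int \<alpha> g)\<^sup>2) * int (card {\<sigma> \<in> perms n. cycle_type n \<sigma> = cycle_type n g}))
      = (of_int (fact n) :: complex)"
    using column_orthogonality[OF assms] assms by (simp add: irr_char_int)
  then show ?thesis by (simp only: of_int_eq_iff)
qed

text \<open>Let \<open>h\<close> arise from \<open>g\<close> by merging two cycles of length \<open>a\<close>. All values at \<open>g\<close> are at most \<open>1\<close>
in absolute value and agree modulo \<open>2\<close> with those at \<open>h\<close>, so their squares are bounded by the
squares of the latter. By column orthogonality, the class of \<open>h\<close> is then at most as large as
that of \<open>g\<close>; comparison with \<open>merge_count\<close> yields the bound. If the bound is attained, then
all these inequalities are equalities, and the values at \<open>h\<close> are again \<open>0\<close> or \<open>\<plusminus>1\<close>.\<close>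

lemma merge_sign_element:
  assumes sg: "sign_element g" and a: "a > 0" and m: "count (cycle_type n g) a = m" "m \<ge> 2"
    and k: "count (cycle_type n g) (2 * a) = k"
  obtains h where "h \<in> perms n" "cycle_type n h + {#a, a#} = cycle_type n g + {#2 * a#}"
    "a * (m * (m - 1)) \<le> 2 * (k + 1)"
    "a * (m * (m - 1)) = 2 * (k + 1) \<longrightarrow> sign_element h"
proof -
  have g: "g \<in> perms n" using sg by (simp add: sign_element_def)
  let ?X = "{x. x < n \<and> card (orbit g x) = a}"
  have cardX: "card ?X = a * m" using card_points_in_cycles[OF g, of a] m(1) by simp
  have am: "a * m = a + a * (m - 1)" using m(2) by (cases m) auto
  then have "card ?X > 0" using cardX a by simp
  then obtain x where x: "x < n" "card (orbit g x) = a" by (auto simp: card_gt_0_iff)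
  have "\<not> ?X \<subseteq> orbit g x"
  proof
    assume "?X \<subseteq> orbit g x"
    then have "card ?X \<le> a" using card_mono[OF perms_orbit_finite[OF g]] x(2) by metis
    then show False using cardX am a m(2) by simp
  qed
  then obtain y where y: "y < n" "card (orbit g y) = a" "y \<notin> orbit g x" by auto
  obtain h where h: "h \<in> perms n" "g = local_power 2 (orbit h x) h"
    "cycle_type n h + {#a, a#} = cycle_type n g + {#2 * a#}"
    by (rule merge_orbits[OF g x(1) y(1,3) x(2) y(2)])
  define K where "K u = card {\<sigma> \<in> perms n. cycle_type n \<sigma> = cycle_type n u}" for u
  define S where "S u = (\<Sum>\<alpha>\<in>partitions. (char_int \<alpha> u)\<^sup>2)" for u
  have SK: "S u * int (K u) = fact n" if "u \<in> perms n" for u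
    unfolding S_def K_def by (rule column_orthogonality_int[OF that])
  have Kpos: "K u > 0" if "u \<in> perms n" for u
    using that by (auto simp: K_def card_gt_0_iff)
  have val: "char_int \<alpha> g \<in> {0, 1, -1}" if "\<alpha> \<in> partitions" for \<alpha>
  proof -
    have "(of_int (char_int \<alpha> g) :: complex) \<in> {of_int 0, of_int 1, of_int (-1)}"
      using sg that by (simp add: sign_element_def irr_char_int[OF that g, symmetric])
    then show ?thesis by (simp only: insert_iff empty_iff of_int_eq_iff)
  qed
  have le: "(char_int \<alpha> g)\<^sup>2 \<le> (char_int \<alpha> h)\<^sup>2" if \<alpha>: "\<alpha> \<in> partitions" for \<alpha>
  proof (cases "even (char_int \<alpha> g)")
    case True
    then have "char_int \<alpha> g = 0" using val[OF \<alpha>] by auto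
    then show ?thesis by simp
  next
    case False
    then have "odd (char_int \<alpha> h)" using char_int_local_square[OF \<alpha> h(1), of x] h(2) by simp
    then have "char_int \<alpha> h \<noteq> 0" by auto
    then have "1 \<le> (char_int \<alpha> h)\<^sup>2" by (simp add: int_one_le_iff_zero_less)
    then show ?thesis using val[OF \<alpha>] by auto
  qed
  have SS: "S g \<le> S h" unfolding S_def by (rule sum_mono) (rule le)
  have KK: "K h \<le> K g"
  proof (rule ccontr)
    assume "\<not> K h \<le> K g"
    then have "int (K g) < int (K h)" by simp
    moreover have "S g > 0" using SK[OF g] by (metis fact_gt_zero of_nat_0_le_iff zero_less_mult_pos2
        mult_nonpos_nonneg not_less)
    ultimately have "S g * int (K g) < S h * int (K h)" using SS
      by (smt (verit) mult_strict_left_mono mult_right_mono of_nat_0_le_iff)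
    then show False using SK[OF g] SK[OF h(1)] by simp
  qed
  have cnt: "count (cycle_type n h) (2 * a) = k + 1"
    using arg_cong[OF h(3), of "\<lambda>M. count M (2 * a)"] k a by simp
  have "K g * (a * m * (a * m - a)) \<le> K h * (2 * a * (k + 1))"
    using merge_count[OF g a h(3)] unfolding K_def m(1) cnt .
  moreover have "K g * (a * m * (a * m - a)) = a * (K g * (a * (m * (m - 1))))"
    by (simp add: diff_mult_distrib2 mult_ac)
  moreover have "K h * (2 * a * (k + 1)) = a * (K h * (2 * (k + 1)))"
    by (simp only: mult_ac)
  ultimately have main: "K g * (a * (m * (m - 1))) \<le> K h * (2 * (k + 1))"
    by (metis nat_mult_le_cancel1 a)
  also have "\<dots> \<le> K g * (2 * (k + 1))" using KK by (rule mult_right_mono) simp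
  finally have bound: "a * (m * (m - 1)) \<le> 2 * (k + 1)"
    by (simp only: nat_mult_le_cancel1[OF Kpos[OF g]])
  have "sign_element h" if eq: "a * (m * (m - 1)) = 2 * (k + 1)"
  proof -
    have "K g \<le> K h" using main unfolding eq mult_le_cancel2 by simp
    then have "K g = K h" using KK by simp
    then have "S g = S h" using SK[OF g] SK[OF h(1)] Kpos[OF g] by (metis mult_cancel_right of_nat_0_eq_iff less_irrefl)
    then have sums: "(\<Sum>\<alpha>\<in>partitions. (char_int \<alpha> g)\<^sup>2) = (\<Sum>\<alpha>\<in>partitions. (char_int \<alpha> h)\<^sup>2)"
      by (simp only: S_def)
    have sq: "(char_int \<alpha> g)\<^sup>2 = (char_int \<alpha> h)\<^sup>2" if "\<alpha> \<in> partitions" for \<alpha>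
      by (rule sum_mono_inv[OF sums le that finite_index])
    have "irr_char \<alpha> h \<in> {0, 1, -1}" if \<alpha>: "\<alpha> \<in> partitions" for \<alpha>
    proof -
      have "char_int \<alpha> h = char_int \<alpha> g \<or> char_int \<alpha> h = - char_int \<alpha> g"
        using sq[OF \<alpha>] by (simp add: power2_eq_iff[symmetric])
      then show ?thesis using val[OF \<alpha>] irr_char_int[OF \<alpha> h(1)] by auto
    qed
    then show ?thesis using h(1) by (simp add: sign_element_def)
  qed
  then show ?thesis using that h(1,3) bound by blast
qed

text \<open>Take the largest repeated cycle length \<open>a\<close>, so that \<open>2a\<close> occurs at most once. The bound of
\<open>merge_sign_element\<close> becomes \<open>am(m - 1) \<le> 4\<close>. For \<open>a \<ge> 2\<close> this leaves only the cycles
\<open>4, 2, 2\<close>, where the bound is attained; then merging produces a sign element with exactly two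
cycles of length \<open>4\<close> and at most one of length \<open>8\<close>, for which the bound fails.\<close>

lemma sign_element_multiplicity:
  assumes g: "sign_element g" and pos: "0 \<notin># cycle_type n g" and rep: "count (cycle_type n g) b \<ge> 2"
  shows "b = 1 \<and> count (cycle_type n g) b = 2"
proof -
  let ?M = "cycle_type n g"
  define R where "R = {a. count ?M a \<ge> 2}"
  have "R \<subseteq> set_mset ?M" by (auto simp: R_def simp flip: count_greater_zero_iff)
  then have fin: "finite R" by (rule finite_subset) simp
  have bR: "b \<in> R" using rep by (simp add: R_def)
  define a where "a = Max R"
  have aR: "a \<in> R" unfolding a_def using fin bR by (intro Max_in) auto
  have max: "c \<le> a" if "count ?M c \<ge> 2" for c
    unfolding a_def using fin that by (intro Max_ge) (auto simp: R_def)
  define m where "m = count ?M a"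
  have m: "m \<ge> 2" using aR by (simp add: R_def m_def)
  have a: "a > 0"
  proof (rule ccontr)
    assume "\<not> a > 0"
    then have "count ?M 0 \<ge> 2" using m by (simp add: m_def)
    then show False using pos by (simp add: not_in_iff)
  qed
  have small: "count ?M c \<le> 1" if "c > a" for c
    using max[of c] that by linarith
  define k where "k = count ?M (2 * a)"
  have k: "k \<le> 1" using small[of "2 * a"] a by (simp add: k_def)
  obtain h where h: "h \<in> perms n" "cycle_type n h + {#a, a#} = ?M + {#2 * a#}"
    "a * (m * (m - 1)) \<le> 2 * (k + 1)"
    "a * (m * (m - 1)) = 2 * (k + 1) \<longrightarrow> sign_element h"
    by (rule merge_sign_element[OF g a m_def[symmetric] m k_def[symmetric]])
  have mm: "m * (m - 1) \<ge> 2" using m mult_le_mono[of 2 m 1 "m - 1"] by simp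
  have "a = 1"
  proof (rule ccontr)
    assume "a \<noteq> 1"
    then have a2: "a \<ge> 2" using a by simp
    have "a * 2 \<le> a * (m * (m - 1))" using mm by simp
    also have "\<dots> \<le> 4" using h(3) k by simp
    finally have "a = 2" using a2 by simp
    have four: "2 * 2 \<le> a * (m * (m - 1))" by (rule mult_le_mono[OF a2 mm])
    have k1: "k = 1" using order.trans[OF four h(3)] k by simp
    have "a * (m * (m - 1)) = 2 * (k + 1)"
      by (rule le_antisym[OF h(3)]) (use four k1 in simp)
    then have sh: "sign_element h" using h(4) by simp
    have "cycle_type n h + {#2, 2#} = ?M + {#4#}" using h(2) by (simp add: \<open>a = 2\<close>)
    then have "count (cycle_type n h + {#2, 2#}) c = count (?M + {#4#}) c" for c by (simp only:)
    then have cnt: "count (cycle_type n h) c + count {#2, 2#} c = count ?M c + count {#4#} c" for c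
      by (simp only: count_union)
    have c4: "count (cycle_type n h) 4 = 2" using cnt[of 4] k1 by (simp add: k_def \<open>a = 2\<close>)
    have c8: "count (cycle_type n h) (2 * 4) \<le> 1"
      using cnt[of 8] small[of 8] by (simp add: \<open>a = 2\<close>)
    \<comment> \<open>for two cycles of length 4 the bound requires at least three cycles of length 8\<close>
    obtain h' where "4 * (2 * (2 - 1)) \<le> 2 * (count (cycle_type n h) (2 * 4) + 1)"
      by (rule merge_sign_element[OF sh _ c4 order.refl refl]) simp
    then show False using c8 by simp
  qed
  then have "m * (m - 1) \<le> 4" using h(3) k by simp
  moreover have "m * (m - 1) \<ge> 3 * 2" if "m \<ge> 3" using that mult_le_mono[of 3 m 2 "m - 1"] by simp
  ultimately have "m = 2" using m by (cases "m \<ge> 3") auto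
  moreover have "b = a"
  proof -
    have "b \<noteq> 0" using rep pos by (metis not_in_iff not_numeral_le_zero)
    then show ?thesis using max[OF rep] \<open>a = 1\<close> by simp
  qed
  ultimately show ?thesis using \<open>a = 1\<close> by (simp add: m_def)
qed

end

theorem theorem7:
  fixes n :: nat and \<mu> :: "nat list"
  assumes "n > 0" and "sign_partition \<mu> n"
  shows "(\<forall>a\<ge>2. count_list \<mu> a \<le> 1) \<and> count_list \<mu> 1 \<le> 2"
proof -
  interpret sym_algebra n .
  have \<mu>: "is_partition \<mu> n" and val: "\<And>\<alpha>. is_partition \<alpha> n \<Longrightarrow> char_value \<alpha> \<mu> \<in> {0, 1, -1}"
    using assms(2) by (auto simp: sign_partition_def)
  define g where "g = (SOME \<sigma>. \<sigma> \<in> perms n \<and> cycle_type n \<sigma> = mset \<mu>)"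
  have "\<exists>\<sigma>. \<sigma> \<in> perms n \<and> cycle_type n \<sigma> = mset \<mu>"
    using cycle_type_exists[OF \<mu>] by blast
  then have g: "g \<in> perms n \<and> cycle_type n g = mset \<mu>"
    unfolding g_def by (rule someI_ex)
  have "char_value \<alpha> \<mu> = irr_char \<alpha> g" for \<alpha>
    by (simp add: char_value_def is_partition_sum[OF \<mu>] g_def)
  then have sg: "sign_element g"
    using val g by (simp add: sign_element_def partitions_def)
  have pos: "0 \<notin># cycle_type n g" using g \<mu> by (simp add: is_partition_def)
  have cnt: "count (cycle_type n g) a = count_list \<mu> a" for a
    using g by (simp add: count_mset)
  have rep: "a = 1 \<and> count_list \<mu> a = 2" if "count_list \<mu> a \<ge> 2" for a
    using sign_element_multiplicity[OF sg pos, of a] that unfolding cnt by blast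
  show ?thesis
  proof (intro conjI allI impI)
    fix a :: nat assume "a \<ge> 2"
    then show "count_list \<mu> a \<le> 1" using rep[of a] by linarith
  next
    show "count_list \<mu> 1 \<le> 2" using rep[of 1] by linarith
  qed
qed

end
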